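(* Let $\beta_1,\beta_2\in\mathbb{R}$, let $\alpha=\frac{1+\sqrt5}{2}$, and let $$E(\beta_1,\beta_2)=\tfrac15\left[1+\beta_1+2\beta_2+5\beta_1\beta_2+\alpha\left(\beta_1+3\beta_2+8\beta_1\beta_2\right)\right].$$ If the generalized real quaternion algebra $\mathbb{H}(\beta_1,\beta_2)$ is not a division algebra, then there is a natural number $n'$ such that for all $n\ge n'$ the following hold. If $E(\beta_1,\beta_2)>0$, then the Clifford algebra $C(\mathcal{H}_n^{\mathbb{R}})$ associated to the real vector space $\mathcal{H}_n^{\mathbb{R}}$ (equipped with the quadratic form $q_{\mathcal{H}_n^{\mathbb{R}}}$) is isomorphic, as an $\mathbb{R}$-algebra, to the split quaternion algebra $\mathbb{H}(-1,-1)$. If $E(\beta_1,\beta_2)<0$, then the Clifford algebra $C(\mathcal{H}_n^{\mathbb{R}})$ is isomorphic, as an $\mathbb{R}$-algebra, to the division quaternion algebra $\mathbb{H}(1,1)$.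
   Context: For $\beta_1,\beta_2\in\mathbb{R}$, $\mathbb{H}(\beta_1,\beta_2)$ denotes the generalized real quaternion algebra: the unital associative $\mathbb{R}$-algebra with basis $\{1,e_2,e_3,e_4\}$ and multiplication $e_2^2=-\beta_1$, $e_3^2=-\beta_2$, $e_4^2=-\beta_1\beta_2$, $e_2e_3=e_4=-e_3e_2$, $e_2e_4=-\beta_1e_3=-e_4e_2$, $e_3e_4=\beta_2e_2=-e_4e_3$. The norm of $a=a_1\cdot 1+a_2e_2+a_3e_3+a_4e_4$ is $\mathbf{n}(a)=a_1^2+\beta_1a_2^2+\beta_2a_3^2+\beta_1\beta_2a_4^2$. (A split quaternion algebra is one that is not a division algebra.) The Fibonacci numbers are $f_0=0$, $f_1=1$, $f_n=f_{n-1}+f_{n-2}$ for $n\ge 2$. The $n$th Fibonacci quaternion is $F_n=f_n\cdot 1+f_{n+1}e_2+f_{n+2}e_3+f_{n+3}e_4\in\mathbb{H}(\beta_1,\beta_2)$. For $p,q\in\mathbb{R}$, the $n$th generalized Fibonacci quaternion is $H_n^{p,q}=pF_n+qF_{n+1}$, and $\mathcal{H}_n^{\mathbb{R}}=\{H_n^{p,q} : p,q\in\mathbb{R}\}\cup\{0\}$, a real vector space of dimension two with basis $\{F_n,F_{n+1}\}$. It is equipped with the quadratic form $q_{\mathcal{H}_n^{\mathbb{R}}}:\mathcal{H}_n^{\mathbb{R}}\to\mathbb{R}$, $$q_{\mathcal{H}_n^{\mathbb{R}}}(x_1F_n+x_2F_{n+1})=\mathbf{n}(F_n)x_1^2+\mathbf{n}(F_{n+1})x_2^2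 .$$ The Clifford algebra of a real vector space $V$ with quadratic form $q$ is $C(V,q)=T(V)/\mathcal{J}$, where $T(V)$ is the tensor algebra and $\mathcal{J}$ is the two-sided ideal generated by all $x\otimes x-q(x)\cdot 1$, $x\in V$. Here $C(\mathcal{H}_n^{\mathbb{R}})=C(\mathcal{H}_n^{\mathbb{R}},q_{\mathcal{H}_n^{\mathbb{R}}})$. *)

theory Defs
  imports
    "HOL-Algebra.QuotRing"
    "HOL-Algebra.Module"
    "HOL-Number_Theory.Fib"
    "HOL-Analysis.Product_Vector"
begin

section \<open>Associative unital real algebras\<close>

text \<open>
  A real algebra is represented by a record of type \<open>(real, 'a, _) module_scheme\<close>. The locale
  \<^locale>\<open>algebra\<close> is not used, as it requires the algebra to be commutative.
  \<^const>\<open>ideal\<close> and \<^const>\<open>genideal\<close> are two-sided; as the algebras are unital, such an ideal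
  is automatically closed under scalar multiplication.
\<close>

definition alg_quot :: "(real, 'a, 'm) module_scheme \<Rightarrow> 'a set \<Rightarrow> (real, 'a set) module" where
  "alg_quot A I = ring.extend (A Quot I)
     (module.fields (\<lambda>c X. \<Union>x\<in>X. I +>\<^bsub>A\<^esub> (c \<odot>\<^bsub>A\<^esub> x)))"

definition alg_iso :: "(real, 'a, 'm) module_scheme \<Rightarrow> (real, 'b, 'n) module_scheme \<Rightarrow> ('a \<Rightarrow> 'b) set" where
  "alg_iso A B = {h \<in> ring_iso A B. \<forall>c. \<forall>x\<in>carrier A. h (c \<odot>\<^bsub>A\<^esub> x) = c \<odot>\<^bsub>B\<^esub> h x}"

definition alg_isomorphic :: "(real, 'a, 'm) module_scheme \<Rightarrow> (real, 'b, 'n) module_scheme \<Rightarrow> bool"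
    (infix \<open>\<cong>\<^sub>a\<^sub>l\<^sub>g\<close> 50) where
  "A \<cong>\<^sub>a\<^sub>l\<^sub>g B \<longleftrightarrow> alg_iso A B \<noteq> {}"

definition division_algebra :: "(real, 'a, 'm) module_scheme \<Rightarrow> bool" where
  "division_algebra A \<longleftrightarrow> ring A \<and> Units A = carrier A - {\<zero>\<^bsub>A\<^esub>}"


section \<open>Tensor algebra and Clifford algebra\<close>

text \<open>
  The free vector space on the words over \<open>V\<close>, with concatenation of words as product. The
  real vector space \<open>V\<close> is given as a subspace of a type of class \<^class>\<open>real_vector\<close>, but
  the words do not yet see its linear structure.
\<close>

definition word_algebra :: "'v set \<Rightarrow> (real, 'v list \<Rightarrow> real) module" where
  "word_algebra V =
     \<lparr>carrier = {f. finite {w. f w \<noteq> 0} \<and> (\<forall>w. f w \<noteq> 0 \<longrightarrow> set w \<subseteq> V)},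
      mult = (\<lambda>f g w. \<Sum>k\<le>length w. f (take k w) * g (drop k w)),
      one = (\<lambda>w. if w = [] then 1 else 0),
      zero = (\<lambda>w. 0),
      add = (\<lambda>f g w. f w + g w),
      smult = (\<lambda>c f w. c * f w)\<rparr>"

lemma ring_word_algebra: "ring (word_algebra V)"
proof (rule ringI)
  let ?W = "word_algebra V"
  have add: "(\<lambda>w. f w + g w) \<in> carrier ?W" if "f \<in> carrier ?W" "g \<in> carrier ?W" for f g
  proof -
    have "finite ({w. f w \<noteq> 0} \<union> {w. g w \<noteq> 0})"
      using that by (simp add: word_algebra_def)
    then have "finite {w. f w + g w \<noteq> 0}"
      by (rule rev_finite_subset) auto
    moreover have "set w \<subseteq> V" if "f w + g w \<noteq> 0" for w
      using that \<open>f \<in> carrier ?W\<close> \<open>g \<in> carrier ?W\<close> by (cases "f w = 0") (auto simp: word_algebra_def)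
    ultimately show ?thesis
      by (simp add: word_algebra_def)
  qed
  show "abelian_group ?W"
  proof (rule abelian_groupI)
    fix f assume f: "f \<in> carrier ?W"
    show "\<exists>g\<in>carrier ?W. g \<oplus>\<^bsub>?W\<^esub> f = \<zero>\<^bsub>?W\<^esub>"
      by (rule bexI[of _ "\<lambda>w. - f w"]) (use f in \<open>auto simp: word_algebra_def\<close>)
  next
    fix f g assume "f \<in> carrier ?W" "g \<in> carrier ?W"
    then show "f \<oplus>\<^bsub>?W\<^esub> g \<in> carrier ?W"
      using add[of f g] by (simp add: word_algebra_def)
  qed (auto simp: word_algebra_def algebra_simps)
  show "monoid ?W"
  proof (rule monoidI)
    fix f g assume f: "f \<in> carrier ?W" and g: "g \<in> carrier ?W"
    let ?h = "\<lambda>w. \<Sum>k\<le>length w. f (take k w) * g (drop k w)"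
    have split: "\<exists>u v. w = u @ v \<and> f u \<noteq> 0 \<and> g v \<noteq> 0" if nz: "?h w \<noteq> 0" for w
    proof -
      obtain k where "f (take k w) * g (drop k w) \<noteq> 0"
        using sum.not_neutral_contains_not_neutral[OF nz] by blast
      then show ?thesis
        by (intro exI[of _ "take k w"] exI[of _ "drop k w"]) auto
    qed
    have "finite ((\<lambda>(u, v). u @ v) ` ({w. f w \<noteq> 0} \<times> {w. g w \<noteq> 0}))"
      using f g by (simp add: word_algebra_def)
    then have "finite {w. ?h w \<noteq> 0}"
      by (rule rev_finite_subset) (use split in fastforce)
    moreover have "set w \<subseteq> V" if "?h w \<noteq> 0" for w
      using split[OF that] f g by (fastforce simp: word_algebra_def)
    ultimately show "f \<otimes>\<^bsub>?W\<^esub> g \<in> carrier ?W"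
      by (simp add: word_algebra_def)
  next
    fix f g h :: "'a list \<Rightarrow> real"
    have "(\<Sum>k\<le>length w. (\<Sum>j\<le>length (take k w). f (take j (take k w)) * g (drop j (take k w))) * h (drop k w)) =
        (\<Sum>j\<le>length w. f (take j w) * (\<Sum>i\<le>length (drop j w). g (take i (drop j w)) * h (drop i (drop j w))))"
      (is "?L = ?R") for w
    proof -
      have "?L = (\<Sum>k\<le>length w. \<Sum>j\<le>k. f (take j w) * g (take (k - j) (drop j w)) * h (drop k w))"
        by (intro sum.cong) (auto simp: sum_distrib_right drop_take min_absorb1)
      also have "\<dots> = (\<Sum>(k, j)\<in>(SIGMA k:{..length w}. {..k}).
          f (take j w) * g (take (k - j) (drop j w)) * h (drop k w))"
        by (simp add: sum.Sigma)
      also have "\<dots> = (\<Sum>(j, i)\<in>(SIGMA j:{..length w}. {..length w - j}).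
          f (take j w) * g (take i (drop j w)) * h (drop (i + j) w))"
        by (rule sum.reindex_bij_witness[of _ "\<lambda>(j, i). (i + j, j)" "\<lambda>(k, j). (j, k - j)"]) auto
      also have "\<dots> = (\<Sum>j\<le>length w. \<Sum>i\<le>length w - j.
          f (take j w) * g (take i (drop j w)) * h (drop (i + j) w))"
        by (simp add: sum.Sigma)
      also have "\<dots> = ?R"
        by (intro sum.cong) (auto simp: sum_distrib_left mult.assoc)
      finally show ?thesis .
    qed
    then show "f \<otimes>\<^bsub>?W\<^esub> g \<otimes>\<^bsub>?W\<^esub> h = f \<otimes>\<^bsub>?W\<^esub> (g \<otimes>\<^bsub>?W\<^esub> h)"
      by (simp add: word_algebra_def)
  next
    fix f :: "'a list \<Rightarrow> real"
    have "(\<Sum>k\<le>length w. (if take k w = [] then 1 else 0) * f (drop k w)) = f w" for w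
      by (subst sum.mono_neutral_right[of _ "{0}"]) auto
    then show "\<one>\<^bsub>?W\<^esub> \<otimes>\<^bsub>?W\<^esub> f = f"
      by (simp add: word_algebra_def)
    have "(\<Sum>k\<le>length w. f (take k w) * (if drop k w = [] then 1 else 0)) = f w" for w
      by (subst sum.mono_neutral_right[of _ "{length w}"]) auto
    then show "f \<otimes>\<^bsub>?W\<^esub> \<one>\<^bsub>?W\<^esub> = f"
      by (simp add: word_algebra_def)
  qed (simp add: word_algebra_def)
qed (auto simp: word_algebra_def algebra_simps sum.distrib)

definition word :: "'v list \<Rightarrow> 'v list \<Rightarrow> real" where
  "word u = (\<lambda>w. if w = u then 1 else 0)"

text \<open>
  The two-sided ideal generated by \<open>[a x + b y] - a [x] - b [y]\<close> is homogeneous for word length.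
  Its component in degree \<open>k\<close> is spanned by
  \<open>u [a x + b y] w - a u [x] w - b u [y] w\<close> with \<open>length u + length w + 1 = k\<close>. These
  are the relations expressing multilinearity, by which the free vector space on \<open>V\<^sup>k\<close>
  is divided to give the \<open>k\<close>-th tensor power of \<open>V\<close>. So the quotient is the direct sum of
  all tensor powers of \<open>V\<close>, and the class of \<open>[x\<^sub>1, \<dots>, x\<^sub>k]\<close> is
  \<open>x\<^sub>1 \<otimes> \<dots> \<otimes> x\<^sub>k\<close>.
\<close>

definition multilinear_ideal :: "'v::real_vector set \<Rightarrow> ('v list \<Rightarrow> real) set" where
  "multilinear_ideal V = Idl\<^bsub>word_algebra V\<^esub>
     {\<lambda>w. word [a *\<^sub>R x + b *\<^sub>R y] w - a * word [x] w - b * word [y] w | a b x y. x \<in> V \<and> y \<in> V}"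

definition tensor_algebra :: "'v::real_vector set \<Rightarrow> (real, ('v list \<Rightarrow> real) set) module" where
  "tensor_algebra V = alg_quot (word_algebra V) (multilinear_ideal V)"

definition tensor_of :: "'v::real_vector set \<Rightarrow> 'v \<Rightarrow> ('v list \<Rightarrow> real) set" where
  "tensor_of V x = multilinear_ideal V +>\<^bsub>word_algebra V\<^esub> word [x]"

definition clifford_ideal ::
    "'v::real_vector set \<Rightarrow> ('v \<Rightarrow> real) \<Rightarrow> ('v list \<Rightarrow> real) set set" where
  "clifford_ideal V q = (let T = tensor_algebra V in
     Idl\<^bsub>T\<^esub> {tensor_of V x \<otimes>\<^bsub>T\<^esub> tensor_of V x \<ominus>\<^bsub>T\<^esub> q x \<odot>\<^bsub>T\<^esub> \<one>\<^bsub>T\<^esub> | x. x \<in> V})"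

definition clifford_algebra ::
    "'v::real_vector set \<Rightarrow> ('v \<Rightarrow> real) \<Rightarrow> (real, ('v list \<Rightarrow> real) set set) module" where
  "clifford_algebra V q = alg_quot (tensor_algebra V) (clifford_ideal V q)"


section \<open>Generalized quaternion algebras\<close>

text \<open>The tuple \<open>(a\<^sub>1, a\<^sub>2, a\<^sub>3, a\<^sub>4)\<close> stands for \<open>a\<^sub>1 \<cdot> 1 + a\<^sub>2 e\<^sub>2 + a\<^sub>3 e\<^sub>3 + a\<^sub>4 e\<^sub>4\<close>.\<close>

type_synonym quat = "real \<times> real \<times> real \<times> real"

fun quat_mult :: "real \<Rightarrow> real \<Rightarrow> quat \<Rightarrow> quat \<Rightarrow> quat" where
  "quat_mult \<beta>1 \<beta>2 (a1, a2, a3, a4) (b1, b2, b3, b4) =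
     (a1 * b1 - \<beta>1 * a2 * b2 - \<beta>2 * a3 * b3 - \<beta>1 * \<beta>2 * a4 * b4,
      a1 * b2 + a2 * b1 + \<beta>2 * a3 * b4 - \<beta>2 * a4 * b3,
      a1 * b3 + a3 * b1 - \<beta>1 * a2 * b4 + \<beta>1 * a4 * b2,
      a1 * b4 + a4 * b1 + a2 * b3 - a3 * b2)"

definition quaternion_algebra :: "real \<Rightarrow> real \<Rightarrow> (real, quat) module" where
  "quaternion_algebra \<beta>1 \<beta>2 =
     \<lparr>carrier = UNIV, mult = quat_mult \<beta>1 \<beta>2, one = (1, 0, 0, 0), zero = 0,
      add = (+), smult = (*\<^sub>R)\<rparr>"

fun quat_norm :: "real \<Rightarrow> real \<Rightarrow> quat \<Rightarrow> real" where
  "quat_norm \<beta>1 \<beta>2 (a1, a2, a3, a4) = a1\<^sup>2 + \<beta>1 * a2\<^sup>2 + \<beta>2 * a3\<^sup>2 + \<beta>1 * \<beta>2 * a4\<^sup>2"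

lemma quat_mult_table:
  defines "e1 \<equiv> (1, 0, 0, 0)" and "e2 \<equiv> (0, 1, 0, 0)" and "e3 \<equiv> (0, 0, 1, 0)" and "e4 \<equiv> (0, 0, 0, 1)"
  shows "quat_mult \<beta>1 \<beta>2 e1 a = a" "quat_mult \<beta>1 \<beta>2 a e1 = a"
    "quat_mult \<beta>1 \<beta>2 e2 e2 = (- \<beta>1) *\<^sub>R e1"
    "quat_mult \<beta>1 \<beta>2 e3 e3 = (- \<beta>2) *\<^sub>R e1"
    "quat_mult \<beta>1 \<beta>2 e4 e4 = (- \<beta>1 * \<beta>2) *\<^sub>R e1"
    "quat_mult \<beta>1 \<beta>2 e2 e3 = e4" "quat_mult \<beta>1 \<beta>2 e3 e2 = - e4"
    "quat_mult \<beta>1 \<beta>2 e2 e4 = (- \<beta>1) *\<^sub>R e3" "quat_mult \<beta>1 \<beta>2 e4 e2 = \<beta>1 *\<^sub>R e3"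
    "quat_mult \<beta>1 \<beta>2 e3 e4 = \<beta>2 *\<^sub>R e2" "quat_mult \<beta>1 \<beta>2 e4 e3 = (- \<beta>2) *\<^sub>R e2"
  by (cases a; simp add: assms)+

lemma ring_quaternion_algebra: "ring (quaternion_algebra \<beta>1 \<beta>2)"
proof (rule ringI)
  show "abelian_group (quaternion_algebra \<beta>1 \<beta>2)"
  proof (rule abelian_groupI)
    fix x assume "x \<in> carrier (quaternion_algebra \<beta>1 \<beta>2)"
    show "\<exists>y\<in>carrier (quaternion_algebra \<beta>1 \<beta>2).
        y \<oplus>\<^bsub>quaternion_algebra \<beta>1 \<beta>2\<^esub> x = \<zero>\<^bsub>quaternion_algebra \<beta>1 \<beta>2\<^esub>"
      by (rule bexI[of _ "- x"]) (auto simp: quaternion_algebra_def)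
  qed (auto simp: quaternion_algebra_def)
  show "monoid (quaternion_algebra \<beta>1 \<beta>2)"
    by (rule monoidI) (auto simp: quaternion_algebra_def algebra_simps)
qed (auto simp: quaternion_algebra_def algebra_simps)

lemma division_algebra_quaternion_1_1: "division_algebra (quaternion_algebra 1 1)"
proof -
  have "\<exists>b. quat_mult 1 1 b a = (1, 0, 0, 0) \<and> quat_mult 1 1 a b = (1, 0, 0, 0)" if "a \<noteq> 0" for a
  proof -
    obtain a1 a2 a3 a4 where a: "a = (a1, a2, a3, a4)" by (cases a)
    define N where "N = a1\<^sup>2 + a2\<^sup>2 + a3\<^sup>2 + a4\<^sup>2"
    have "a1\<^sup>2 > 0 \<or> a2\<^sup>2 > 0 \<or> a3\<^sup>2 > 0 \<or> a4\<^sup>2 > 0"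
      using that by (auto simp: a zero_prod_def)
    then have N: "N \<noteq> 0"
      unfolding N_def by (smt (verit) zero_le_power2)
    have "(a1 * a1 + a2 * a2 + a3 * a3 + a4 * a4) / N = 1"
      using N by (simp add: N_def power2_eq_square)
    then show ?thesis
      by (intro exI[of _ "(a1 / N, - a2 / N, - a3 / N, - a4 / N)"])
         (simp add: a add_divide_distrib algebra_simps)
  qed
  moreover have "quat_mult 1 1 b 0 \<noteq> (1, 0, 0, 0)" for b
    by (cases b) (simp add: zero_prod_def)
  ultimately have "{y. \<exists>x. quat_mult 1 1 x y = (1, 0, 0, 0) \<and> quat_mult 1 1 y x = (1, 0, 0, 0)} = UNIV - {0}"
    by blast
  then show ?thesis
    by (simp add: division_algebra_def ring_quaternion_algebra Units_def)
       (simp add: quaternion_algebra_def)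
qed

lemma not_division_algebra_quaternion: "\<not> division_algebra (quaternion_algebra (-1) (-1))"
proof
  assume "division_algebra (quaternion_algebra (-1) (-1))"
  then have "(1, 1, 0, 0) \<in> Units (quaternion_algebra (-1) (-1))"
    by (auto simp: division_algebra_def quaternion_algebra_def zero_prod_def)
  then obtain b where "quat_mult (-1) (-1) (1, 1, 0, 0) b = (1, 0, 0, 0)"
    by (auto simp: Units_def quaternion_algebra_def)
  then show False
    by (cases b) auto
qed


section \<open>Generalized Fibonacci quaternions\<close>

definition fib_quat :: "nat \<Rightarrow> quat" where
  "fib_quat n = (fib n, fib (n + 1), fib (n + 2), fib (n + 3))"

definition gen_fib_quat :: "real \<Rightarrow> real \<Rightarrow> nat \<Rightarrow> quat" where
  "gen_fib_quat p q n = p *\<^sub>R fib_quat n + q *\<^sub>R fib_quat (n + 1)"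

definition fib_quat_space :: "nat \<Rightarrow> quat set" where
  "fib_quat_space n = {gen_fib_quat p q n | p q. True} \<union> {0}"

definition fib_quat_form :: "real \<Rightarrow> real \<Rightarrow> nat \<Rightarrow> quat \<Rightarrow> real" where
  "fib_quat_form \<beta>1 \<beta>2 n v = (THE r. \<exists>x1 x2. v = x1 *\<^sub>R fib_quat n + x2 *\<^sub>R fib_quat (n + 1) \<and>
     r = quat_norm \<beta>1 \<beta>2 (fib_quat n) * x1\<^sup>2 + quat_norm \<beta>1 \<beta>2 (fib_quat (n + 1)) * x2\<^sup>2)"

lemma fib_quat_inject:
  assumes "x1 *\<^sub>R fib_quat n + x2 *\<^sub>R fib_quat (n + 1) = y1 *\<^sub>R fib_quat n + y2 *\<^sub>R fib_quat (n + 1)"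
  shows "x1 = y1 \<and> x2 = y2"
  using assms
proof (induction n arbitrary: x1 x2 y1 y2)
  case 0
  then show ?case by (auto simp: fib_quat_def)
next
  case (Suc n)
  have step: "fib_quat (Suc n + 1) = fib_quat n + fib_quat (n + 1)"
    by (simp add: fib_quat_def eval_nat_numeral)
  have "x2 *\<^sub>R fib_quat n + (x1 + x2) *\<^sub>R fib_quat (n + 1)
      = y2 *\<^sub>R fib_quat n + (y1 + y2) *\<^sub>R fib_quat (n + 1)"
    using Suc.prems unfolding step by (simp add: algebra_simps)
  from Suc.IH[OF this] show ?case by simp
qed

lemma fib_quat_form_eq:
  "fib_quat_form \<beta>1 \<beta>2 n (x1 *\<^sub>R fib_quat n + x2 *\<^sub>R fib_quat (n + 1)) =
     quat_norm \<beta>1 \<beta>2 (fib_quat n) * x1\<^sup>2 + quat_norm \<beta>1 \<beta>2 (fib_quat (n + 1)) * x2\<^sup>2"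
  unfolding fib_quat_form_def
  by (rule the_equality) (use fib_quat_inject in blast)+

definition E_coeff :: "real \<Rightarrow> real \<Rightarrow> real" where
  "E_coeff \<beta>1 \<beta>2 = (let \<alpha> = (1 + sqrt 5) / 2 in
     1 / 5 * (1 + \<beta>1 + 2 * \<beta>2 + 5 * \<beta>1 * \<beta>2 + \<alpha> * (\<beta>1 + 3 * \<beta>2 + 8 * \<beta>1 * \<beta>2)))"

end

theory Submission
  imports Defs
begin

text \<open>
  The quadratic form on the plane spanned by the Fibonacci quaternions \<open>F\<^sub>n\<close> and \<open>F\<^sub>n\<^sub>+\<^sub>1\<close> is
  diagonal with entries \<open>n(F\<^sub>n)\<close> and \<open>n(F\<^sub>n\<^sub>+\<^sub>1)\<close>. The Clifford algebra of a diagonal form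
  \<open>a x\<^sup>2 + b y\<^sup>2\<close> is generated by two anticommuting elements with squares \<open>a\<close> and \<open>b\<close>, so it is the
  quaternion algebra \<open>H(-a, -b)\<close> (\<open>clifford_plane\<close>). Over the reals, rescaling the generators
  shows that \<open>H(-a, -b)\<close> depends only on the signs of \<open>a\<close> and \<open>b\<close>
  (\<open>quaternion_algebra_rescale\<close>): two positive entries give \<open>H(-1, -1)\<close> and two negative ones give
  \<open>H(1, 1)\<close>. Finally \<open>f\<^sub>n\<close> is asymptotic to \<open>\<alpha>\<^sup>n / sqrt 5\<close>, so \<open>n(F\<^sub>n) / \<alpha>\<^sup>2\<^sup>n\<close> tends to
  \<open>E(\<beta>\<^sub>1, \<beta>\<^sub>2)\<close> (\<open>quat_norm_fib_quat_asymptotics\<close>). Hence \<open>n(F\<^sub>n)\<close> and \<open>n(F\<^sub>n\<^sub>+\<^sub>1)\<close> both have the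
  sign of \<open>E(\<beta>\<^sub>1, \<beta>\<^sub>2)\<close> once \<open>n\<close> is large and this limit is not zero.

  The Clifford algebra is an iterated quotient of the algebra of words over the plane. Apart from
  the linear map from the plane to it, the proof uses only three properties: its universal property
  (\<open>clifford_universal\<close>), the relation that each vector squares to its value under the form
  (\<open>clifford_of_square\<close>), and the fact that the vectors generate it (\<open>clifford_algebra_induct\<close>). The
  universal property yields a homomorphism to \<open>H(-a, -b)\<close>; the other two show that \<open>1, u, v, u v\<close>
  span the Clifford algebra, which makes this homomorphism injective.
\<close>

section \<open>Real algebras and their homomorphisms\<close>

locale real_algebra = ring A for A :: "(real, 'a, 'm) module_scheme" (structure) +
  assumes smult_closed [simp]: "x \<in> carrier A \<Longrightarrow> c \<odot> x \<in> carrier A"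
    and smult_left_distrib: "x \<in> carrier A \<Longrightarrow> (c + d) \<odot> x = c \<odot> x \<oplus> d \<odot> x"
    and smult_right_distrib:
      "x \<in> carrier A \<Longrightarrow> y \<in> carrier A \<Longrightarrow> c \<odot> (x \<oplus> y) = c \<odot> x \<oplus> c \<odot> y"
    and smult_smult [simp]: "x \<in> carrier A \<Longrightarrow> c \<odot> (d \<odot> x) = (c * d) \<odot> x"
    and smult_one_left [simp]: "x \<in> carrier A \<Longrightarrow> 1 \<odot> x = x"
    and smult_mult_left [simp]:
      "x \<in> carrier A \<Longrightarrow> y \<in> carrier A \<Longrightarrow> (c \<odot> x) \<otimes> y = c \<odot> (x \<otimes> y)"
    and smult_mult_right [simp]:
      "x \<in> carrier A \<Longrightarrow> y \<in> carrier A \<Longrightarrow> x \<otimes> (c \<odot> y) = c \<odot> (x \<otimes> y)"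
begin

lemma smult_zero_left [simp]: "x \<in> carrier A \<Longrightarrow> 0 \<odot> x = \<zero>"
  using smult_left_distrib[of x 0 0] by (simp add: add.l_cancel_one')

lemma smult_zero_right [simp]: "c \<odot> \<zero> = \<zero>"
  using smult_right_distrib[of \<zero> \<zero> c] by (simp add: add.l_cancel_one')

lemma smult_minus_one: "x \<in> carrier A \<Longrightarrow> (-1) \<odot> x = \<ominus> x"
  using smult_left_distrib[of x "-1" 1] by (simp add: minus_equality)

lemma right_minus_eq [simp]:
  assumes "x \<in> carrier A" "y \<in> carrier A"
  shows "x \<ominus> y = \<zero> \<longleftrightarrow> x = y"
proof
  assume "x \<ominus> y = \<zero>"
  then show "x = y"
    using assms minus_equality[of x "\<ominus> y"] by (simp add: a_minus_def)
qed (use assms in \<open>simp add: a_minus_def r_neg\<close>)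

end

definition alg_hom :: "(real, 'a, 'm) module_scheme \<Rightarrow> (real, 'b, 'n) module_scheme \<Rightarrow> ('a \<Rightarrow> 'b) set" where
  "alg_hom A B = {h \<in> ring_hom A B. \<forall>c. \<forall>x\<in>carrier A. h (c \<odot>\<^bsub>A\<^esub> x) = c \<odot>\<^bsub>B\<^esub> h x}"

lemma alg_hom_closed: "h \<in> alg_hom A B \<Longrightarrow> x \<in> carrier A \<Longrightarrow> h x \<in> carrier B"
  by (auto simp: alg_hom_def ring_hom_closed)

lemma alg_hom_mult:
  "h \<in> alg_hom A B \<Longrightarrow> x \<in> carrier A \<Longrightarrow> y \<in> carrier A \<Longrightarrow> h (x \<otimes>\<^bsub>A\<^esub> y) = h x \<otimes>\<^bsub>B\<^esub> h y"
  by (auto simp: alg_hom_def ring_hom_mult)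

lemma alg_hom_add:
  "h \<in> alg_hom A B \<Longrightarrow> x \<in> carrier A \<Longrightarrow> y \<in> carrier A \<Longrightarrow> h (x \<oplus>\<^bsub>A\<^esub> y) = h x \<oplus>\<^bsub>B\<^esub> h y"
  by (auto simp: alg_hom_def ring_hom_add)

lemma alg_hom_one: "h \<in> alg_hom A B \<Longrightarrow> h \<one>\<^bsub>A\<^esub> = \<one>\<^bsub>B\<^esub>"
  by (auto simp: alg_hom_def ring_hom_one)

lemma alg_hom_smult: "h \<in> alg_hom A B \<Longrightarrow> x \<in> carrier A \<Longrightarrow> h (c \<odot>\<^bsub>A\<^esub> x) = c \<odot>\<^bsub>B\<^esub> h x"
  by (auto simp: alg_hom_def)

lemma alg_hom_zero: "real_algebra A \<Longrightarrow> real_algebra B \<Longrightarrow> h \<in> alg_hom A B \<Longrightarrow> h \<zero>\<^bsub>A\<^esub> = \<zero>\<^bsub>B\<^esub>"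
  by (auto simp: alg_hom_def real_algebra_def intro: ring_hom_zero)

lemmas alg_hom_simps = alg_hom_closed alg_hom_mult alg_hom_add alg_hom_one alg_hom_smult

lemma alg_homI:
  assumes "\<And>x. x \<in> carrier A \<Longrightarrow> h x \<in> carrier B"
    and "\<And>x y. x \<in> carrier A \<Longrightarrow> y \<in> carrier A \<Longrightarrow> h (x \<otimes>\<^bsub>A\<^esub> y) = h x \<otimes>\<^bsub>B\<^esub> h y"
    and "\<And>x y. x \<in> carrier A \<Longrightarrow> y \<in> carrier A \<Longrightarrow> h (x \<oplus>\<^bsub>A\<^esub> y) = h x \<oplus>\<^bsub>B\<^esub> h y"
    and "h \<one>\<^bsub>A\<^esub> = \<one>\<^bsub>B\<^esub>"
    and "\<And>c x. x \<in> carrier A \<Longrightarrow> h (c \<odot>\<^bsub>A\<^esub> x) = c \<odot>\<^bsub>B\<^esub> h x"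
  shows "h \<in> alg_hom A B"
  using assms by (auto simp: alg_hom_def intro: ring_hom_memI)

lemma alg_hom_comp: "h \<in> alg_hom A B \<Longrightarrow> k \<in> alg_hom B C \<Longrightarrow> (\<lambda>x. k (h x)) \<in> alg_hom A C"
  by (rule alg_homI) (simp_all add: alg_hom_simps)

lemma alg_iso_iff: "h \<in> alg_iso A B \<longleftrightarrow> h \<in> alg_hom A B \<and> bij_betw h (carrier A) (carrier B)"
  by (auto simp: alg_iso_def alg_hom_def ring_iso_def)

lemma alg_isomorphicI:
  "h \<in> alg_hom A B \<Longrightarrow> bij_betw h (carrier A) (carrier B) \<Longrightarrow> A \<cong>\<^sub>a\<^sub>l\<^sub>g B"
  unfolding alg_isomorphic_def using alg_iso_iff by blast

lemma alg_isomorphic_trans: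
  assumes "A \<cong>\<^sub>a\<^sub>l\<^sub>g B" and "B \<cong>\<^sub>a\<^sub>l\<^sub>g C"
  shows "A \<cong>\<^sub>a\<^sub>l\<^sub>g C"
proof -
  obtain h k where "h \<in> alg_iso A B" "k \<in> alg_iso B C"
    using assms by (auto simp: alg_isomorphic_def)
  then have "(\<lambda>x. k (h x)) \<in> alg_hom A C" "bij_betw (k \<circ> h) (carrier A) (carrier C)"
    by (auto simp: alg_iso_iff intro: alg_hom_comp bij_betw_trans)
  then show ?thesis
    by (auto simp: comp_def intro: alg_isomorphicI)
qed


section \<open>Quotient algebras\<close>

lemma ideal_smult:
  assumes "real_algebra A" "ideal I A" "x \<in> I"
  shows "c \<odot>\<^bsub>A\<^esub> x \<in> I"
proof -
  interpret real_algebra A by fact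
  interpret ideal I A by fact
  have "(c \<odot>\<^bsub>A\<^esub> \<one>\<^bsub>A\<^esub>) \<otimes>\<^bsub>A\<^esub> x \<in> I"
    using assms(3) by (intro I_l_closed) auto
  then show ?thesis
    using assms(3) by simp
qed

lemma alg_quot_smult:
  assumes "real_algebra A" "ideal I A" "x \<in> carrier A"
  shows "c \<odot>\<^bsub>alg_quot A I\<^esub> (I +>\<^bsub>A\<^esub> x) = I +>\<^bsub>A\<^esub> (c \<odot>\<^bsub>A\<^esub> x)"
proof -
  interpret real_algebra A by fact
  interpret ideal I A by fact
  have "I +>\<^bsub>A\<^esub> (c \<odot>\<^bsub>A\<^esub> y) = I +>\<^bsub>A\<^esub> (c \<odot>\<^bsub>A\<^esub> x)" if y: "y \<in> I +>\<^bsub>A\<^esub> x" for y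
  proof -
    obtain i where i: "i \<in> I" "y = i \<oplus>\<^bsub>A\<^esub> x"
      using y by (auto simp: a_r_coset_def')
    have "c \<odot>\<^bsub>A\<^esub> y = c \<odot>\<^bsub>A\<^esub> i \<oplus>\<^bsub>A\<^esub> c \<odot>\<^bsub>A\<^esub> x"
      using i assms(3) a_Hcarr by (simp add: smult_right_distrib)
    then have "c \<odot>\<^bsub>A\<^esub> y \<in> I +>\<^bsub>A\<^esub> (c \<odot>\<^bsub>A\<^esub> x)"
      using ideal_smult[OF assms(1,2) i(1)] by (auto simp: a_r_coset_def')
    then show ?thesis
      using a_repr_independence' assms(3) by auto
  qed
  moreover have "x \<in> I +>\<^bsub>A\<^esub> x"
    using assms(3) by (rule a_rcos_self)
  ultimately have "(\<Union>y\<in>I +>\<^bsub>A\<^esub> x. I +>\<^bsub>A\<^esub> (c \<odot>\<^bsub>A\<^esub> y)) = I +>\<^bsub>A\<^esub> (c \<odot>\<^bsub>A\<^esub> x)"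
    by blast
  then show ?thesis
    by (simp add: alg_quot_def ring.defs module.defs)
qed

lemma alg_quot_carrier: "carrier (alg_quot A I) = (+>\<^bsub>A\<^esub>) I ` carrier A"
  by (auto simp: alg_quot_def ring.defs module.defs FactRing_def A_RCOSETS_def')

lemma alg_quot_projection:
  assumes "real_algebra A" "ideal I A"
  shows "(+>\<^bsub>A\<^esub>) I \<in> alg_hom A (alg_quot A I)"
proof -
  interpret ideal I A by fact
  have "(+>\<^bsub>A\<^esub>) I \<in> ring_hom A (A Quot I)"
    by (rule rcos_ring_hom)
  then have "(+>\<^bsub>A\<^esub>) I \<in> ring_hom A (alg_quot A I)"
    by (auto simp: ring_hom_def alg_quot_def ring.defs module.defs)
  then show ?thesis
    using alg_quot_smult[OF assms] by (simp add: alg_hom_def)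
qed

text \<open>
  The algebra laws are equations, so they pass to homomorphic images. A homomorphism preserves
  one, sums and products by definition, but not zero, which is why the zero of \<open>B\<close> is given.
\<close>

lemma real_algebra_surj_image:
  assumes "real_algebra A" "h \<in> alg_hom A B" "h ` carrier A = carrier B" "\<zero>\<^bsub>B\<^esub> = h \<zero>\<^bsub>A\<^esub>"
  shows "real_algebra B"
proof -
  interpret real_algebra A by fact
  have "h \<in> ring_hom A B"
    using assms(2) by (simp add: alg_hom_def)
  from ring_hom_imp_img_ring[OF this] have "ring B"
    by (simp add: assms(3) flip: assms(4))
  have rep: "\<exists>x\<in>carrier A. y = h x" if "y \<in> carrier B" for y
    using that assms(3) by auto
  note [simp] = alg_hom_simps(1)[OF assms(2)]
    and [simp] = alg_hom_simps(2-)[OF assms(2), symmetric]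
  show ?thesis
  proof (intro real_algebra.intro real_algebra_axioms.intro)
    fix c d x y
    show "(c + d) \<odot>\<^bsub>B\<^esub> x = c \<odot>\<^bsub>B\<^esub> x \<oplus>\<^bsub>B\<^esub> d \<odot>\<^bsub>B\<^esub> x" if "x \<in> carrier B"
      using rep[OF that] by (auto simp: smult_left_distrib)
    show "c \<odot>\<^bsub>B\<^esub> (x \<oplus>\<^bsub>B\<^esub> y) = c \<odot>\<^bsub>B\<^esub> x \<oplus>\<^bsub>B\<^esub> c \<odot>\<^bsub>B\<^esub> y" if "x \<in> carrier B" "y \<in> carrier B"
      using rep[OF that(1)] rep[OF that(2)] by (auto simp: smult_right_distrib)
    show "(c \<odot>\<^bsub>B\<^esub> x) \<otimes>\<^bsub>B\<^esub> y = c \<odot>\<^bsub>B\<^esub> (x \<otimes>\<^bsub>B\<^esub> y)" if "x \<in> carrier B" "y \<in> carrier B"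
      using rep[OF that(1)] rep[OF that(2)] by auto
    show "x \<otimes>\<^bsub>B\<^esub> (c \<odot>\<^bsub>B\<^esub> y) = c \<odot>\<^bsub>B\<^esub> (x \<otimes>\<^bsub>B\<^esub> y)" if "x \<in> carrier B" "y \<in> carrier B"
      using rep[OF that(1)] rep[OF that(2)] by auto
  qed (use rep \<open>ring B\<close> in force)+
qed

lemma real_algebra_alg_quot:
  assumes "real_algebra A" "ideal I A"
  shows "real_algebra (alg_quot A I)"
proof (rule real_algebra_surj_image[OF assms(1) alg_quot_projection[OF assms]])
  interpret ideal I A by fact
  have "I +>\<^bsub>A\<^esub> \<zero>\<^bsub>A\<^esub> = I"
    by (simp add: a_rcos_const)
  then show "\<zero>\<^bsub>alg_quot A I\<^esub> = I +>\<^bsub>A\<^esub> \<zero>\<^bsub>A\<^esub>"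
    by (simp add: alg_quot_def ring.defs module.defs FactRing_def)
qed (rule alg_quot_carrier[symmetric])

lemma alg_quot_zero:
  assumes "real_algebra A" "ideal I A" "x \<in> I"
  shows "I +>\<^bsub>A\<^esub> x = \<zero>\<^bsub>alg_quot A I\<^esub>"
proof -
  interpret ideal I A by fact
  show ?thesis
    using assms(3) by (simp add: a_rcos_const alg_quot_def ring.defs module.defs FactRing_def)
qed

text \<open>
  A homomorphism that vanishes on the ideal is constant on every coset, so its image of a coset is
  a singleton.
\<close>

lemma alg_quot_factor:
  assumes "real_algebra A" "real_algebra B" "ideal I A"
    and h: "h \<in> alg_hom A B" and ker: "\<And>x. x \<in> I \<Longrightarrow> h x = \<zero>\<^bsub>B\<^esub>"
  shows "\<exists>k\<in>alg_hom (alg_quot A I) B. \<forall>x\<in>carrier A. k (I +>\<^bsub>A\<^esub> x) = h x"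
proof
  interpret A: real_algebra A by fact
  interpret B: real_algebra B by fact
  interpret ideal I A by fact
  let ?k = "\<lambda>X. the_elem (h ` X)"
  have k: "?k (I +>\<^bsub>A\<^esub> x) = h x" if x: "x \<in> carrier A" for x
  proof -
    have "h y = h x" if y: "y \<in> I +>\<^bsub>A\<^esub> x" for y
    proof -
      obtain i where i: "i \<in> I" "y = i \<oplus>\<^bsub>A\<^esub> x"
        using y by (auto simp: a_r_coset_def')
      have "h y = h i \<oplus>\<^bsub>B\<^esub> h x"
        unfolding i(2) using i(1) x a_Hcarr by (intro alg_hom_add[OF h]) auto
      then show ?thesis
        using ker[OF i(1)] alg_hom_closed[OF h x] by simp
    qed
    moreover have "x \<in> I +>\<^bsub>A\<^esub> x"
      using x by (rule a_rcos_self)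
    ultimately have "h ` (I +>\<^bsub>A\<^esub> x) = {h x}"
      by blast
    then show ?thesis
      by simp
  qed
  then show "\<forall>x\<in>carrier A. ?k (I +>\<^bsub>A\<^esub> x) = h x"
    by blast
  note pr = alg_quot_projection[OF assms(1,3)]
  have rep: "\<exists>x\<in>carrier A. X = I +>\<^bsub>A\<^esub> x" if "X \<in> carrier (alg_quot A I)" for X
    using that by (auto simp: alg_quot_carrier)
  show "?k \<in> alg_hom (alg_quot A I) B"
  proof (rule alg_homI)
    fix X Y c
    show "?k \<one>\<^bsub>alg_quot A I\<^esub> = \<one>\<^bsub>B\<^esub>"
      unfolding alg_hom_one[OF pr, symmetric] using k[OF A.one_closed] alg_hom_one[OF h] by (rule trans)
    show "?k X \<in> carrier B" if "X \<in> carrier (alg_quot A I)"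
      using rep[OF that] k alg_hom_closed[OF h] by auto
    show "?k (c \<odot>\<^bsub>alg_quot A I\<^esub> X) = c \<odot>\<^bsub>B\<^esub> ?k X" if X: "X \<in> carrier (alg_quot A I)"
    proof -
      obtain x where x: "x \<in> carrier A" "X = I +>\<^bsub>A\<^esub> x"
        using rep[OF X] by blast
      show ?thesis
        unfolding x(2) alg_hom_smult[OF pr x(1), symmetric]
        using x(1) by (simp only: k A.smult_closed alg_hom_smult[OF h])
    qed
    assume "X \<in> carrier (alg_quot A I)" "Y \<in> carrier (alg_quot A I)"
    then obtain x y where x: "x \<in> carrier A" "X = I +>\<^bsub>A\<^esub> x" and y: "y \<in> carrier A" "Y = I +>\<^bsub>A\<^esub> y"
      using rep by meson
    show "?k (X \<otimes>\<^bsub>alg_quot A I\<^esub> Y) = ?k X \<otimes>\<^bsub>B\<^esub> ?k Y"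
      unfolding x(2) y(2) alg_hom_mult[OF pr x(1) y(1), symmetric]
      using x(1) y(1) by (simp only: k A.m_closed alg_hom_mult[OF h])
    show "?k (X \<oplus>\<^bsub>alg_quot A I\<^esub> Y) = ?k X \<oplus>\<^bsub>B\<^esub> ?k Y"
      unfolding x(2) y(2) alg_hom_add[OF pr x(1) y(1), symmetric]
      using x(1) y(1) by (simp only: k A.add.m_closed alg_hom_add[OF h])
  qed
qed

text \<open>
  The kernel is an ideal, so it contains the ideal generated by \<open>S\<close> as soon as it contains \<open>S\<close>.
\<close>

lemma alg_hom_zero_on_genideal:
  assumes "real_algebra A" "real_algebra B" "h \<in> alg_hom A B"
    and S: "S \<subseteq> carrier A" "\<And>x. x \<in> S \<Longrightarrow> h x = \<zero>\<^bsub>B\<^esub>" and x: "x \<in> Idl\<^bsub>A\<^esub> S"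
  shows "h x = \<zero>\<^bsub>B\<^esub>"
proof -
  interpret A: real_algebra A by fact
  interpret B: real_algebra B by fact
  have hom: "ring_hom_ring A B h"
    using assms(3) by (intro ring_hom_ringI2 A.ring_axioms B.ring_axioms) (simp add: alg_hom_def)
  have "Idl\<^bsub>A\<^esub> S \<subseteq> {x \<in> carrier A. h x = \<zero>\<^bsub>B\<^esub>}"
  proof (rule A.genideal_minimal)
    show "ideal {x \<in> carrier A. h x = \<zero>\<^bsub>B\<^esub>} A"
      using ring_hom_ring.kernel_is_ideal[OF hom] by (simp only: a_kernel_def')
    show "S \<subseteq> {x \<in> carrier A. h x = \<zero>\<^bsub>B\<^esub>}"
      using S by blast
  qed
  then show ?thesis
    using x by blast
qed

lemma alg_hom_minus:
  assumes "real_algebra A" "real_algebra B" "h \<in> alg_hom A B" "x \<in> carrier A" "y \<in> carrier A"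
  shows "h (x \<ominus>\<^bsub>A\<^esub> y) = h x \<ominus>\<^bsub>B\<^esub> h y"
proof -
  interpret A: real_algebra A by fact
  interpret B: real_algebra B by fact
  show ?thesis
    using assms(4,5) alg_hom_smult[OF assms(3), of y "-1"]
    by (simp add: a_minus_def alg_hom_simps[OF assms(3)] A.smult_minus_one B.smult_minus_one)
qed

section \<open>The word algebra\<close>

lemma real_algebra_word_algebra: "real_algebra (word_algebra V)"
proof -
  have "(\<lambda>w. c * f w) \<in> carrier (word_algebra V)" if f: "f \<in> carrier (word_algebra V)" for c and f :: "'a list \<Rightarrow> real"
  proof -
    have "{w. c * f w \<noteq> 0} \<subseteq> {w. f w \<noteq> 0}"
      by auto
    then show ?thesis
      using f by (auto simp: word_algebra_def intro: finite_subset)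
  qed
  then show ?thesis
    by (intro real_algebra.intro real_algebra_axioms.intro ring_word_algebra)
       (auto simp: word_algebra_def fun_eq_iff algebra_simps sum_distrib_left)
qed

interpretation W: real_algebra "word_algebra V" for V
  by (rule real_algebra_word_algebra)

lemma word_in_word_algebra [simp]: "set u \<subseteq> V \<Longrightarrow> word u \<in> carrier (word_algebra V)"
  by (auto simp: word_algebra_def word_def)

lemma word_Nil: "word [] = \<one>\<^bsub>word_algebra V\<^esub>"
  by (simp add: word_algebra_def word_def)

lemma word_append: "word (u @ v) = word u \<otimes>\<^bsub>word_algebra V\<^esub> word v"
proof
  fix w
  have "(\<Sum>k\<le>length w. word u (take k w) * word v (drop k w)) = word (u @ v) w"
  proof (cases "w = u @ v")
    case True
    have "(\<Sum>k\<le>length w. word u (take k w) * word v (drop k w))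
        = (\<Sum>k\<in>{length u}. word u (take k w) * word v (drop k w))"
      by (rule sum.mono_neutral_right) (auto simp: True word_def dest: arg_cong[of _ u length])
    then show ?thesis
      by (simp add: True word_def)
  next
    case False
    then have "word u (take k w) * word v (drop k w) = 0" for k
      using append_take_drop_id[of k w] by (auto simp: word_def)
    then show ?thesis
      using False by (simp only: sum.neutral_const) (simp add: word_def)
  qed
  then show "word (u @ v) w = (word u \<otimes>\<^bsub>word_algebra V\<^esub> word v) w"
    by (simp add: word_algebra_def)
qed

text \<open>
  The words form a basis of the word algebra. The induction removes one word from the support at
  a time.
\<close>

lemma word_algebra_induct [consumes 1, case_names zero add]:
  assumes "f \<in> carrier (word_algebra V)"
    and zero: "P \<zero>\<^bsub>word_algebra V\<^esub>"
    and add: "\<And>c w f. set w \<subseteq> V \<Longrightarrow> f \<in> carrier (word_algebra V) \<Longrightarrow> P f \<Longrightarrow>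
      P (c \<odot>\<^bsub>word_algebra V\<^esub> word w \<oplus>\<^bsub>word_algebra V\<^esub> f)"
  shows "P f"
proof -
  have "P f" if "finite S" "f \<in> carrier (word_algebra V)" "{w. f w \<noteq> 0} \<subseteq> S" for S f
    using that
  proof (induction S arbitrary: f rule: finite_induct)
    case empty
    then have "f = \<zero>\<^bsub>word_algebra V\<^esub>"
      by (auto simp: word_algebra_def)
    then show ?case
      using zero by simp
  next
    case (insert w S)
    show ?case
    proof (cases "f w = 0")
      case True
      then show ?thesis
        using insert.prems by (intro insert.IH) auto
    next
      case False
      let ?f = "f(w := 0)"
      have "{u. ?f u \<noteq> 0} \<subseteq> {u. f u \<noteq> 0}"
        by auto
      then have f: "?f \<in> carrier (word_algebra V)"
        using insert.prems(1) by (auto simp: word_algebra_def intro: finite_subset)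
      then have "P ?f"
        using insert.prems(2) by (intro insert.IH f) auto
      moreover have "f = f w \<odot>\<^bsub>word_algebra V\<^esub> word w \<oplus>\<^bsub>word_algebra V\<^esub> ?f"
        by (auto simp: word_algebra_def word_def)
      moreover have "set w \<subseteq> V"
        using False insert.prems(1) by (auto simp: word_algebra_def)
      ultimately show ?thesis
        using add[OF _ f, of w "f w"] by simp
    qed
  qed
  moreover have "finite {w. f w \<noteq> 0}"
    using assms(1) by (simp add: word_algebra_def)
  ultimately show ?thesis
    using assms(1) by blast
qed

lemma (in real_algebra) smult_finsum:
  "finite S \<Longrightarrow> f \<in> S \<rightarrow> carrier A \<Longrightarrow> c \<odot> finsum A f S = finsum A (\<lambda>i. c \<odot> f i) S"
  by (induction S rule: finite_induct) (simp_all add: Pi_def smult_right_distrib)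

text \<open>
  Substitution of \<open>g x\<close> for each letter \<open>x\<close>. By \<open>word_eval_hom\<close> below it is a homomorphism for
  every \<open>g\<close> that maps letters into the carrier, which makes the word algebra the free algebra on
  the set of letters.
\<close>

definition word_eval :: "(real, 'b, 'n) module_scheme \<Rightarrow> ('v \<Rightarrow> 'b) \<Rightarrow> ('v list \<Rightarrow> real) \<Rightarrow> 'b" where
  "word_eval B g f = finsum B (\<lambda>w. f w \<odot>\<^bsub>B\<^esub> foldr (\<lambda>x y. g x \<otimes>\<^bsub>B\<^esub> y) w \<one>\<^bsub>B\<^esub>) {w. f w \<noteq> 0}"

context
  fixes B :: "(real, 'b, 'n) module_scheme" (structure) and V :: "'v set" and g :: "'v \<Rightarrow> 'b"
  assumes B: "real_algebra B" and g: "\<And>x. x \<in> V \<Longrightarrow> g x \<in> carrier B"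
begin

interpretation B: real_algebra B by (rule B)

lemma word_product_closed: "set w \<subseteq> V \<Longrightarrow> foldr (\<lambda>x y. g x \<otimes> y) w \<one> \<in> carrier B"
  by (induction w) (auto intro: g)

lemma word_product_append:
  assumes "set u \<subseteq> V" "set v \<subseteq> V"
  shows "foldr (\<lambda>x y. g x \<otimes> y) (u @ v) \<one> = foldr (\<lambda>x y. g x \<otimes> y) u \<one> \<otimes> foldr (\<lambda>x y. g x \<otimes> y) v \<one>"
  using assms(1)
proof (induction u)
  case Nil
  then show ?case
    using word_product_closed[OF assms(2)] by simp
next
  case (Cons x u)
  then show ?case
    using word_product_closed[OF assms(2)] word_product_closed[of u] g[of x] by (simp add: B.m_assoc)
qed

text \<open>
  Used to put the sums for two elements of the word algebra over a common index set.
\<close>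

lemma word_eval_superset:
  assumes "finite S" "{w. f w \<noteq> 0} \<subseteq> S" "\<And>w. w \<in> S \<Longrightarrow> set w \<subseteq> V"
  shows "word_eval B g f = finsum B (\<lambda>w. f w \<odot> foldr (\<lambda>x y. g x \<otimes> y) w \<one>) S"
  unfolding word_eval_def using assms
  by (intro B.add.finprod_mono_neutral_cong_left) (auto simp: word_product_closed)

lemma word_eval_closed: "f \<in> carrier (word_algebra V) \<Longrightarrow> word_eval B g f \<in> carrier B"
  unfolding word_eval_def by (intro B.finsum_closed) (auto simp: word_algebra_def word_product_closed)

lemma word_eval_add:
  assumes f: "f \<in> carrier (word_algebra V)" and h: "h \<in> carrier (word_algebra V)"
  shows "word_eval B g (f \<oplus>\<^bsub>word_algebra V\<^esub> h) = word_eval B g f \<oplus> word_eval B g h"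
proof -
  let ?S = "{w. f w \<noteq> 0} \<union> {w. h w \<noteq> 0}"
  let ?m = "\<lambda>w. foldr (\<lambda>x y. g x \<otimes> y) w \<one>"
  have S: "finite ?S" "\<And>w. w \<in> ?S \<Longrightarrow> set w \<subseteq> V"
    using f h by (auto simp: word_algebra_def)
  have m: "?m w \<in> carrier B" if "w \<in> ?S" for w
    using S(2)[OF that] by (rule word_product_closed)
  have "word_eval B g (f \<oplus>\<^bsub>word_algebra V\<^esub> h) = finsum B (\<lambda>w. (f \<oplus>\<^bsub>word_algebra V\<^esub> h) w \<odot> ?m w) ?S"
    by (intro word_eval_superset S) (auto simp: word_algebra_def)
  also have "\<dots> = finsum B (\<lambda>w. f w \<odot> ?m w \<oplus> h w \<odot> ?m w) ?S"
    using m by (intro B.finsum_cong') (auto simp: word_algebra_def B.smult_left_distrib)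
  also have "\<dots> = finsum B (\<lambda>w. f w \<odot> ?m w) ?S \<oplus> finsum B (\<lambda>w. h w \<odot> ?m w) ?S"
    using m by (intro B.finsum_addf) auto
  also have "\<dots> = word_eval B g f \<oplus> word_eval B g h"
    using S by (subst (1 2) word_eval_superset[of ?S]) auto
  finally show ?thesis .
qed

lemma word_eval_smult:
  assumes f: "f \<in> carrier (word_algebra V)"
  shows "word_eval B g (c \<odot>\<^bsub>word_algebra V\<^esub> f) = c \<odot> word_eval B g f"
proof -
  let ?S = "{w. f w \<noteq> 0}"
  let ?m = "\<lambda>w. foldr (\<lambda>x y. g x \<otimes> y) w \<one>"
  have S: "finite ?S" "\<And>w. w \<in> ?S \<Longrightarrow> set w \<subseteq> V"
    using f by (auto simp: word_algebra_def)
  have "word_eval B g (c \<odot>\<^bsub>word_algebra V\<^esub> f) = finsum B (\<lambda>w. (c \<odot>\<^bsub>word_algebra V\<^esub> f) w \<odot> ?m w) ?S"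
    by (intro word_eval_superset S) (auto simp: word_algebra_def)
  also have "\<dots> = finsum B (\<lambda>w. c \<odot> (f w \<odot> ?m w)) ?S"
    using S(2) word_product_closed
    by (intro B.finsum_cong') (auto simp: word_algebra_def)
  also have "\<dots> = c \<odot> word_eval B g f"
    unfolding word_eval_def using S word_product_closed by (intro B.smult_finsum[symmetric]) auto
  finally show ?thesis .
qed

lemma word_eval_word:
  assumes "set u \<subseteq> V"
  shows "word_eval B g (word u) = foldr (\<lambda>x y. g x \<otimes> y) u \<one>"
proof -
  have "word_eval B g (word u) = finsum B (\<lambda>w. word u w \<odot> foldr (\<lambda>x y. g x \<otimes> y) w \<one>) {u}"
    using assms by (intro word_eval_superset) (auto simp: word_def)
  then show ?thesis
    using word_product_closed[OF assms] by (simp add: word_def)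
qed

text \<open>
  Linearity reduces multiplicativity to words, in the left factor and then in the right one. For
  words it is the rule for the product over a concatenation.
\<close>

lemma word_eval_hom: "word_eval B g \<in> alg_hom (word_algebra V) B"
proof (rule alg_homI)
  show "word_eval B g \<one>\<^bsub>word_algebra V\<^esub> = \<one>"
    using word_eval_word[of "[]"] by (simp add: word_Nil[of V])
  have word: "word_eval B g (word u \<otimes>\<^bsub>word_algebra V\<^esub> f) = word_eval B g (word u) \<otimes> word_eval B g f"
    if f: "f \<in> carrier (word_algebra V)" and u: "set u \<subseteq> V" for u f
    using f
  proof (induction rule: word_algebra_induct)
    case zero
    have "word_eval B g \<zero>\<^bsub>word_algebra V\<^esub> = \<zero>"
      by (simp add: word_eval_def word_algebra_def)
    then show ?case
      using u word_eval_closed[of "word u"] by simp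
  next
    case (add c w f)
    have "word u \<otimes>\<^bsub>word_algebra V\<^esub> (c \<odot>\<^bsub>word_algebra V\<^esub> word w \<oplus>\<^bsub>word_algebra V\<^esub> f)
        = c \<odot>\<^bsub>word_algebra V\<^esub> word (u @ w) \<oplus>\<^bsub>word_algebra V\<^esub> word u \<otimes>\<^bsub>word_algebra V\<^esub> f"
      using add u by (simp add: W.r_distr word_append[of u w V])
    then show ?case
      using add u word_eval_closed[of f] word_product_closed[OF u] word_product_closed[of w]
      by (simp add: word_eval_add word_eval_smult word_eval_word word_product_append B.r_distr
          del: foldr_append)
  qed
  fix f h assume f: "f \<in> carrier (word_algebra V)" and h: "h \<in> carrier (word_algebra V)"
  show "word_eval B g (f \<otimes>\<^bsub>word_algebra V\<^esub> h) = word_eval B g f \<otimes> word_eval B g h"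
    using f
  proof (induction rule: word_algebra_induct)
    case zero
    have "word_eval B g \<zero>\<^bsub>word_algebra V\<^esub> = \<zero>"
      by (simp add: word_eval_def word_algebra_def)
    then show ?case
      using h word_eval_closed[of h] by simp
  next
    case (add c w f)
    then show ?case
      using h word_eval_closed[of f] word_eval_closed[of h] word_eval_closed[of "word w"]
      by (simp add: W.l_distr B.l_distr word_eval_add word_eval_smult word)
  qed
qed (auto simp: word_eval_closed word_eval_add word_eval_smult)

end

section \<open>The tensor algebra and the Clifford algebra\<close>

lemma multilinear_relation:
  assumes "subspace V" "x \<in> V" "y \<in> V"
  shows "(\<lambda>w. word [a *\<^sub>R x + b *\<^sub>R y] w - a * word [x] w - b * word [y] w)
    = word [a *\<^sub>R x + b *\<^sub>R y] \<ominus>\<^bsub>word_algebra V\<^esub>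
       (a \<odot>\<^bsub>word_algebra V\<^esub> word [x] \<oplus>\<^bsub>word_algebra V\<^esub> b \<odot>\<^bsub>word_algebra V\<^esub> word [y])"
  (is "_ = ?p \<ominus>\<^bsub>_\<^esub> ?r")
proof -
  have "?p \<ominus>\<^bsub>word_algebra V\<^esub> ?r = ?p \<oplus>\<^bsub>word_algebra V\<^esub> (-1) \<odot>\<^bsub>word_algebra V\<^esub> ?r"
    using assms by (subst W.smult_minus_one) (auto simp: a_minus_def)
  then show ?thesis
    by (simp add: word_algebra_def fun_eq_iff algebra_simps)
qed

text \<open>
  The generators of the multilinear ideal, expressed by the algebra operations instead of
  pointwise, so that homomorphisms can be applied to them.
\<close>

definition multilinear_relations :: "'v::real_vector set \<Rightarrow> ('v list \<Rightarrow> real) set" where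
  "multilinear_relations V =
    {word [a *\<^sub>R x + b *\<^sub>R y] \<ominus>\<^bsub>word_algebra V\<^esub>
       (a \<odot>\<^bsub>word_algebra V\<^esub> word [x] \<oplus>\<^bsub>word_algebra V\<^esub> b \<odot>\<^bsub>word_algebra V\<^esub> word [y])
     | a b x y. x \<in> V \<and> y \<in> V}"

lemma multilinear_ideal_alt:
  assumes "subspace V"
  shows "multilinear_ideal V = Idl\<^bsub>word_algebra V\<^esub> (multilinear_relations V)"
proof -
  have conj_cong_rev: "(r \<Longrightarrow> p = p') \<Longrightarrow> (p \<and> r) = (p' \<and> r)" for p p' r
    by blast
  have "{\<lambda>w. word [a *\<^sub>R x + b *\<^sub>R y] w - a * word [x] w - b * word [y] w | a b x y. x \<in> V \<and> y \<in> V}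
    = {word [a *\<^sub>R x + b *\<^sub>R y] \<ominus>\<^bsub>word_algebra V\<^esub>
       (a \<odot>\<^bsub>word_algebra V\<^esub> word [x] \<oplus>\<^bsub>word_algebra V\<^esub> b \<odot>\<^bsub>word_algebra V\<^esub> word [y])
     | a b x y. x \<in> V \<and> y \<in> V}"
    by (intro Collect_cong ex_cong1 conj_cong_rev) (simp only: multilinear_relation[OF assms])
  then show ?thesis
    by (simp only: multilinear_ideal_def multilinear_relations_def)
qed

definition clifford_relations :: "'v::real_vector set \<Rightarrow> ('v \<Rightarrow> real) \<Rightarrow> ('v list \<Rightarrow> real) set set" where
  "clifford_relations V q = {tensor_of V x \<otimes>\<^bsub>tensor_algebra V\<^esub> tensor_of V x \<ominus>\<^bsub>tensor_algebra V\<^esub>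
      q x \<odot>\<^bsub>tensor_algebra V\<^esub> \<one>\<^bsub>tensor_algebra V\<^esub> | x. x \<in> V}"

lemma clifford_ideal_alt: "clifford_ideal V q = Idl\<^bsub>tensor_algebra V\<^esub> (clifford_relations V q)"
  by (simp add: clifford_ideal_def clifford_relations_def Let_def)

definition clifford_of :: "'v::real_vector set \<Rightarrow> ('v \<Rightarrow> real) \<Rightarrow> 'v \<Rightarrow> ('v list \<Rightarrow> real) set set" where
  "clifford_of V q x = clifford_ideal V q +>\<^bsub>tensor_algebra V\<^esub> tensor_of V x"

context
  fixes V :: "'v::real_vector set" and q :: "'v \<Rightarrow> real"
  assumes V: "subspace V"
begin

lemma subspace_combination: "x \<in> V \<Longrightarrow> y \<in> V \<Longrightarrow> a *\<^sub>R x + b *\<^sub>R y \<in> V"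
  using V by (simp add: subspace_add subspace_scale)

lemma multilinear_relations_closed: "multilinear_relations V \<subseteq> carrier (word_algebra V)"
  unfolding multilinear_relations_def by (auto simp: subspace_combination)

lemma ideal_multilinear_ideal: "ideal (multilinear_ideal V) (word_algebra V)"
  unfolding multilinear_ideal_alt[OF V]
  by (rule W.genideal_ideal[OF multilinear_relations_closed])

lemma real_algebra_tensor_algebra: "real_algebra (tensor_algebra V)"
  unfolding tensor_algebra_def
  by (rule real_algebra_alg_quot[OF real_algebra_word_algebra ideal_multilinear_ideal])

interpretation T: real_algebra "tensor_algebra V"
  by (rule real_algebra_tensor_algebra)

lemma tensor_projection: "(+>\<^bsub>word_algebra V\<^esub>) (multilinear_ideal V) \<in> alg_hom (word_algebra V) (tensor_algebra V)"
  unfolding tensor_algebra_def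
  by (rule alg_quot_projection[OF real_algebra_word_algebra ideal_multilinear_ideal])

lemma tensor_of_closed: "x \<in> V \<Longrightarrow> tensor_of V x \<in> carrier (tensor_algebra V)"
  unfolding tensor_of_def by (rule alg_hom_closed[OF tensor_projection]) simp

text \<open>
  The difference of the two sides is the class of a generator of the multilinear ideal.
\<close>

lemma tensor_of_linear:
  assumes "x \<in> V" "y \<in> V"
  shows "tensor_of V (a *\<^sub>R x + b *\<^sub>R y)
    = a \<odot>\<^bsub>tensor_algebra V\<^esub> tensor_of V x \<oplus>\<^bsub>tensor_algebra V\<^esub> b \<odot>\<^bsub>tensor_algebra V\<^esub> tensor_of V y"
    (is "?l = ?r")
proof -
  let ?g = "word [a *\<^sub>R x + b *\<^sub>R y] \<ominus>\<^bsub>word_algebra V\<^esub>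
     (a \<odot>\<^bsub>word_algebra V\<^esub> word [x] \<oplus>\<^bsub>word_algebra V\<^esub> b \<odot>\<^bsub>word_algebra V\<^esub> word [y])"
  have "?g \<in> multilinear_ideal V"
    unfolding multilinear_ideal_alt[OF V]
    by (rule subsetD[OF W.genideal_self])
      ((rule multilinear_relations_closed), (use assms in \<open>unfold multilinear_relations_def, blast\<close>))
  then have "multilinear_ideal V +>\<^bsub>word_algebra V\<^esub> ?g = \<zero>\<^bsub>tensor_algebra V\<^esub>"
    unfolding tensor_algebra_def
    by (rule alg_quot_zero[OF real_algebra_word_algebra ideal_multilinear_ideal])
  moreover have "multilinear_ideal V +>\<^bsub>word_algebra V\<^esub> ?g = ?l \<ominus>\<^bsub>tensor_algebra V\<^esub> ?r"
    using assms subspace_combination[OF assms]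
    by (simp add: alg_hom_minus[OF real_algebra_word_algebra real_algebra_tensor_algebra tensor_projection]
        alg_hom_simps[OF tensor_projection] flip: tensor_of_def)
  ultimately show ?thesis
    using assms subspace_combination[OF assms] by (simp add: tensor_of_closed)
qed

lemma clifford_relations_closed: "clifford_relations V q \<subseteq> carrier (tensor_algebra V)"
  unfolding clifford_relations_def by (auto simp: tensor_of_closed)

lemma ideal_clifford_ideal: "ideal (clifford_ideal V q) (tensor_algebra V)"
  unfolding clifford_ideal_alt
  by (rule T.genideal_ideal[OF clifford_relations_closed])

lemma real_algebra_clifford_algebra: "real_algebra (clifford_algebra V q)"
  unfolding clifford_algebra_def
  by (rule real_algebra_alg_quot[OF real_algebra_tensor_algebra ideal_clifford_ideal])

interpretation C: real_algebra "clifford_algebra V q"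
  by (rule real_algebra_clifford_algebra)

lemma clifford_projection:
  "(+>\<^bsub>tensor_algebra V\<^esub>) (clifford_ideal V q) \<in> alg_hom (tensor_algebra V) (clifford_algebra V q)"
  unfolding clifford_algebra_def
  by (rule alg_quot_projection[OF real_algebra_tensor_algebra ideal_clifford_ideal])

lemma clifford_of_closed: "x \<in> V \<Longrightarrow> clifford_of V q x \<in> carrier (clifford_algebra V q)"
  unfolding clifford_of_def by (rule alg_hom_closed[OF clifford_projection]) (rule tensor_of_closed)

lemma clifford_of_linear:
  assumes "x \<in> V" "y \<in> V"
  shows "clifford_of V q (a *\<^sub>R x + b *\<^sub>R y)
    = a \<odot>\<^bsub>clifford_algebra V q\<^esub> clifford_of V q x \<oplus>\<^bsub>clifford_algebra V q\<^esub>
      b \<odot>\<^bsub>clifford_algebra V q\<^esub> clifford_of V q y"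
  using assms
  by (simp add: clifford_of_def tensor_of_linear tensor_of_closed alg_hom_simps[OF clifford_projection])

lemma clifford_of_square:
  assumes "x \<in> V"
  shows "clifford_of V q x \<otimes>\<^bsub>clifford_algebra V q\<^esub> clifford_of V q x
    = q x \<odot>\<^bsub>clifford_algebra V q\<^esub> \<one>\<^bsub>clifford_algebra V q\<^esub>"
    (is "?l = ?r")
proof -
  let ?g = "tensor_of V x \<otimes>\<^bsub>tensor_algebra V\<^esub> tensor_of V x \<ominus>\<^bsub>tensor_algebra V\<^esub>
     q x \<odot>\<^bsub>tensor_algebra V\<^esub> \<one>\<^bsub>tensor_algebra V\<^esub>"
  have "?g \<in> clifford_ideal V q"
    unfolding clifford_ideal_alt
    by (rule subsetD[OF T.genideal_self])
      ((rule clifford_relations_closed), (use assms in \<open>unfold clifford_relations_def, blast\<close>))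
  then have "clifford_ideal V q +>\<^bsub>tensor_algebra V\<^esub> ?g = \<zero>\<^bsub>clifford_algebra V q\<^esub>"
    unfolding clifford_algebra_def
    by (rule alg_quot_zero[OF real_algebra_tensor_algebra ideal_clifford_ideal])
  moreover have "clifford_ideal V q +>\<^bsub>tensor_algebra V\<^esub> ?g = ?l \<ominus>\<^bsub>clifford_algebra V q\<^esub> ?r"
    using assms
    by (simp add: alg_hom_minus[OF real_algebra_tensor_algebra real_algebra_clifford_algebra clifford_projection]
        alg_hom_simps[OF clifford_projection] tensor_of_closed clifford_of_def)
  ultimately show ?thesis
    using assms by (simp add: clifford_of_closed)
qed

text \<open>
  The Clifford algebra is spanned by the products of vectors, because it is a quotient of the
  word algebra. Left multiplication by vectors suffices to build these products, so a linear
  subspace that contains the unit and is closed under it is the whole algebra.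
\<close>

lemma clifford_algebra_induct:
  assumes y: "y \<in> carrier (clifford_algebra V q)"
    and one: "P \<one>\<^bsub>clifford_algebra V q\<^esub>"
    and add: "\<And>x y. x \<in> carrier (clifford_algebra V q) \<Longrightarrow> y \<in> carrier (clifford_algebra V q) \<Longrightarrow>
      P x \<Longrightarrow> P y \<Longrightarrow> P (x \<oplus>\<^bsub>clifford_algebra V q\<^esub> y)"
    and smult: "\<And>c y. y \<in> carrier (clifford_algebra V q) \<Longrightarrow> P y \<Longrightarrow> P (c \<odot>\<^bsub>clifford_algebra V q\<^esub> y)"
    and mult: "\<And>x y. x \<in> V \<Longrightarrow> y \<in> carrier (clifford_algebra V q) \<Longrightarrow> P y \<Longrightarrow>
      P (clifford_of V q x \<otimes>\<^bsub>clifford_algebra V q\<^esub> y)"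
  shows "P y"
proof -
  define p where "p f = clifford_ideal V q +>\<^bsub>tensor_algebra V\<^esub> (multilinear_ideal V +>\<^bsub>word_algebra V\<^esub> f)" for f
  have p: "p \<in> alg_hom (word_algebra V) (clifford_algebra V q)"
    unfolding p_def by (rule alg_hom_comp[OF tensor_projection clifford_projection])
  have word: "P (p (word w))" if "set w \<subseteq> V" for w
    using that
  proof (induction w)
    case Nil
    then show ?case
      using one by (simp add: word_Nil[of V] alg_hom_one[OF p])
  next
    case (Cons x w)
    have "p (word (x # w)) = clifford_of V q x \<otimes>\<^bsub>clifford_algebra V q\<^esub> p (word w)"
      using Cons.prems word_append[of "[x]" w V]
      by (simp add: alg_hom_mult[OF p]) (simp add: p_def clifford_of_def tensor_of_def)
    then show ?case
      using Cons alg_hom_closed[OF p] by (simp add: mult)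
  qed
  have "y \<in> (\<lambda>f. p f) ` carrier (word_algebra V)"
    using y by (auto simp: clifford_algebra_def tensor_algebra_def alg_quot_carrier p_def)
  then obtain f where f: "f \<in> carrier (word_algebra V)" and y: "y = p f"
    by blast
  from f have "P (p f)"
  proof (induction rule: word_algebra_induct)
    case zero
    have "P (0 \<odot>\<^bsub>clifford_algebra V q\<^esub> \<one>\<^bsub>clifford_algebra V q\<^esub>)"
      using one by (intro smult) auto
    then show ?case
      by (simp add: alg_hom_zero[OF real_algebra_word_algebra real_algebra_clifford_algebra p])
  next
    case (add c w f)
    then show ?case
      using word[of w] alg_hom_closed[OF p]
      by (simp add: alg_hom_simps[OF p] assms(3) smult)
  qed
  then show ?thesis
    by (simp add: y)
qed

text \<open>
  The universal property. Substitution of letters defines the extension on words. Linearity of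
  \<open>g\<close> makes it vanish on the multilinear ideal, and the square condition makes the induced map on
  the tensor algebra vanish on the Clifford ideal.
\<close>

lemma clifford_universal:
  assumes B: "real_algebra B"
    and g: "\<And>x. x \<in> V \<Longrightarrow> g x \<in> carrier B"
    and lin: "\<And>a b x y. x \<in> V \<Longrightarrow> y \<in> V \<Longrightarrow>
      g (a *\<^sub>R x + b *\<^sub>R y) = a \<odot>\<^bsub>B\<^esub> g x \<oplus>\<^bsub>B\<^esub> b \<odot>\<^bsub>B\<^esub> g y"
    and square: "\<And>x. x \<in> V \<Longrightarrow> g x \<otimes>\<^bsub>B\<^esub> g x = q x \<odot>\<^bsub>B\<^esub> \<one>\<^bsub>B\<^esub>"
  shows "\<exists>k\<in>alg_hom (clifford_algebra V q) B. \<forall>x\<in>V. k (clifford_of V q x) = g x"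
proof -
  interpret B: real_algebra B by (rule B)
  have ev: "word_eval B g \<in> alg_hom (word_algebra V) B"
    using g by (rule word_eval_hom[OF B])
  have letter: "word_eval B g (word [x]) = g x" if "x \<in> V" for x
    using word_eval_word[of B V g "[x]", OF B] that by (simp add: g)
  have "word_eval B g f = \<zero>\<^bsub>B\<^esub>" if "f \<in> multilinear_ideal V" for f
  proof (rule alg_hom_zero_on_genideal[OF real_algebra_word_algebra B ev])
    show "f \<in> Idl\<^bsub>word_algebra V\<^esub> (multilinear_relations V)"
      using that by (simp only: multilinear_ideal_alt[OF V])
  next
    fix r assume "r \<in> multilinear_relations V"
    then obtain a b x y where r: "r = word [a *\<^sub>R x + b *\<^sub>R y] \<ominus>\<^bsub>word_algebra V\<^esub>
       (a \<odot>\<^bsub>word_algebra V\<^esub> word [x] \<oplus>\<^bsub>word_algebra V\<^esub> b \<odot>\<^bsub>word_algebra V\<^esub> word [y])"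
      and xy: "x \<in> V" "y \<in> V"
      unfolding multilinear_relations_def by blast
    have "word_eval B g r = g (a *\<^sub>R x + b *\<^sub>R y) \<ominus>\<^bsub>B\<^esub> (a \<odot>\<^bsub>B\<^esub> g x \<oplus>\<^bsub>B\<^esub> b \<odot>\<^bsub>B\<^esub> g y)"
      using xy subspace_combination[OF xy] unfolding r
      by (simp add: alg_hom_minus[OF real_algebra_word_algebra B ev] alg_hom_simps[OF ev] letter)
    also have "\<dots> = \<zero>\<^bsub>B\<^esub>"
      using xy by (subst lin) (simp_all add: g)
    finally show "word_eval B g r = \<zero>\<^bsub>B\<^esub>" .
  qed (rule multilinear_relations_closed)
  from alg_quot_factor[OF real_algebra_word_algebra B ideal_multilinear_ideal ev this, folded tensor_algebra_def]
  obtain t where t: "t \<in> alg_hom (tensor_algebra V) B"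
    and t_eval: "\<And>f. f \<in> carrier (word_algebra V) \<Longrightarrow>
      t (multilinear_ideal V +>\<^bsub>word_algebra V\<^esub> f) = word_eval B g f"
    by blast
  have t_of: "t (tensor_of V x) = g x" if "x \<in> V" for x
    using that by (simp add: tensor_of_def t_eval letter)
  have "t X = \<zero>\<^bsub>B\<^esub>" if "X \<in> clifford_ideal V q" for X
  proof (rule alg_hom_zero_on_genideal[OF real_algebra_tensor_algebra B t])
    show "X \<in> Idl\<^bsub>tensor_algebra V\<^esub> (clifford_relations V q)"
      using that by (simp only: clifford_ideal_alt)
  next
    fix R assume "R \<in> clifford_relations V q"
    then obtain x where R: "R = tensor_of V x \<otimes>\<^bsub>tensor_algebra V\<^esub> tensor_of V x \<ominus>\<^bsub>tensor_algebra V\<^esub>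
      q x \<odot>\<^bsub>tensor_algebra V\<^esub> \<one>\<^bsub>tensor_algebra V\<^esub>" and x: "x \<in> V"
      unfolding clifford_relations_def by blast
    have "t R = g x \<otimes>\<^bsub>B\<^esub> g x \<ominus>\<^bsub>B\<^esub> q x \<odot>\<^bsub>B\<^esub> \<one>\<^bsub>B\<^esub>"
      using x unfolding R
      by (simp add: alg_hom_minus[OF real_algebra_tensor_algebra B t] alg_hom_simps[OF t]
          tensor_of_closed t_of)
    then show "t R = \<zero>\<^bsub>B\<^esub>"
      using x by (simp add: square)
  qed (rule clifford_relations_closed)
  from alg_quot_factor[OF real_algebra_tensor_algebra B ideal_clifford_ideal t this, folded clifford_algebra_def]
  obtain k where k: "k \<in> alg_hom (clifford_algebra V q) B"
    and k_of: "\<And>X. X \<in> carrier (tensor_algebra V) \<Longrightarrow> k (clifford_ideal V q +>\<^bsub>tensor_algebra V\<^esub> X) = t X"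
    by blast
  have "k (clifford_of V q x) = g x" if "x \<in> V" for x
    using that by (simp add: clifford_of_def k_of tensor_of_closed t_of)
  with k show ?thesis
    by blast
qed

end

section \<open>Clifford algebras of planes\<close>

text \<open>
  The linear map from the quaternions that sends the basis \<open>1, e\<^sub>2, e\<^sub>3, e\<^sub>4\<close> to
  \<open>1, U, V, U \<otimes> V\<close>.
\<close>

definition quat_comb :: "(real, 'a, 'm) module_scheme \<Rightarrow> 'a \<Rightarrow> 'a \<Rightarrow> quat \<Rightarrow> 'a" where
  "quat_comb A U V = (\<lambda>(a1, a2, a3, a4).
     a1 \<odot>\<^bsub>A\<^esub> \<one>\<^bsub>A\<^esub> \<oplus>\<^bsub>A\<^esub> (a2 \<odot>\<^bsub>A\<^esub> U \<oplus>\<^bsub>A\<^esub> (a3 \<odot>\<^bsub>A\<^esub> V \<oplus>\<^bsub>A\<^esub> a4 \<odot>\<^bsub>A\<^esub> (U \<otimes>\<^bsub>A\<^esub> V))))"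

context real_algebra
begin

text \<open>
  Expanding the square of \<open>U \<oplus> V\<close> gives \<open>a + b\<close> plus the sum of the two mixed products, so this
  sum is zero. The last hypothesis is how the orthogonality of two vectors appears in the
  Clifford algebra.
\<close>

lemma anticommute:
  assumes U: "U \<in> carrier A" and V: "V \<in> carrier A"
    and sq: "U \<otimes> U = a \<odot> \<one>" "V \<otimes> V = b \<odot> \<one>" "(U \<oplus> V) \<otimes> (U \<oplus> V) = (a + b) \<odot> \<one>"
  shows "V \<otimes> U = (-1) \<odot> (U \<otimes> V)"
proof -
  have "(U \<oplus> V) \<otimes> (U \<oplus> V) = (a + b) \<odot> \<one> \<oplus> (V \<otimes> U \<oplus> U \<otimes> V)"
    using U V by (simp add: l_distr r_distr sq(1,2) smult_left_distrib a_ac)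
  then have "V \<otimes> U \<oplus> U \<otimes> V = \<zero>"
    using U V sq(3) by (simp add: add.l_cancel_one')
  then show ?thesis
    using U V by (simp add: smult_minus_one minus_equality)
qed

context
  fixes U V and a b :: real
  assumes U: "U \<in> carrier A" and V: "V \<in> carrier A"
    and UU: "U \<otimes> U = a \<odot> \<one>" and VV: "V \<otimes> V = b \<odot> \<one>"
    and VU: "V \<otimes> U = (-1) \<odot> (U \<otimes> V)"
begin

lemma quat_comb_closed: "quat_comb A U V h \<in> carrier A"
  using U V by (cases h) (simp add: quat_comb_def)

lemma quat_comb_add: "quat_comb A U V (h + h') = quat_comb A U V h \<oplus> quat_comb A U V h'"
  using U V by (cases h; cases h') (simp add: quat_comb_def smult_left_distrib a_ac)

lemma quat_comb_smult: "quat_comb A U V (c *\<^sub>R h) = c \<odot> quat_comb A U V h"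
  using U V by (cases h) (simp add: quat_comb_def smult_right_distrib)

text \<open>
  The relations move each generator past the other and reduce its square to a scalar. So the span
  of \<open>1, U, V, U \<otimes> V\<close> is closed under left multiplication by \<open>U\<close> and \<open>V\<close>, as needed to apply
  \<open>clifford_algebra_induct\<close>.
\<close>

lemma mult_quat_comb:
  "U \<otimes> quat_comb A U V (a1, a2, a3, a4) = quat_comb A U V (a * a2, a1, a * a4, a3)"
  "V \<otimes> quat_comb A U V (a1, a2, a3, a4) = quat_comb A U V (b * a3, - b * a4, a1, - a2)"
proof -
  have "U \<otimes> (U \<otimes> V) = a \<odot> V"
    using U V by (simp add: UU flip: m_assoc)
  then show "U \<otimes> quat_comb A U V (a1, a2, a3, a4) = quat_comb A U V (a * a2, a1, a * a4, a3)"
    using U V by (simp add: quat_comb_def r_distr UU a_ac mult.commute)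
  have "V \<otimes> (U \<otimes> V) = (V \<otimes> U) \<otimes> V"
    using U V by (simp add: m_assoc)
  also have "\<dots> = (- b) \<odot> U"
    using U V by (simp add: VU m_assoc VV)
  finally show "V \<otimes> quat_comb A U V (a1, a2, a3, a4) = quat_comb A U V (b * a3, - b * a4, a1, - a2)"
    using U V by (simp add: quat_comb_def r_distr VU VV a_ac mult.commute)
qed

end

end

lemma real_algebra_quaternion_algebra: "real_algebra (quaternion_algebra \<beta>1 \<beta>2)"
  by (intro real_algebra.intro real_algebra_axioms.intro ring_quaternion_algebra)
     (auto simp: quaternion_algebra_def algebra_simps)

text \<open>
  The signs differ because \<open>e\<^sub>2\<close> has square \<open>- \<beta>\<^sub>1\<close> in \<open>H(\<beta>\<^sub>1, \<beta>\<^sub>2)\<close>, whereas \<open>u\<close> has square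
  \<open>q u = a\<close> in the Clifford algebra. The universal property gives a homomorphism \<open>k\<close> to the
  quaternion algebra with \<open>u \<mapsto> e\<^sub>2\<close> and \<open>v \<mapsto> e\<^sub>3\<close>. The linear map \<open>?s\<close> in the other direction,
  with \<open>e\<^sub>4 \<mapsto> u v\<close>, is a section of \<open>k\<close>, and it is onto since \<open>1, u, v, u v\<close> span the Clifford
  algebra. So \<open>k\<close> is bijective, and the linear independence of \<open>1, u, v, u v\<close> comes from the
  quaternion side instead of from an analysis of the two ideals.
\<close>

lemma clifford_plane:
  fixes u v :: "'v::real_vector"
  assumes indep: "\<And>x y. x *\<^sub>R u + y *\<^sub>R v = 0 \<Longrightarrow> x = 0 \<and> y = 0"
    and V: "V = {x *\<^sub>R u + y *\<^sub>R v | x y. True}"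
    and q: "\<And>x y. q (x *\<^sub>R u + y *\<^sub>R v) = a * x\<^sup>2 + b * y\<^sup>2"
  shows "clifford_algebra V q \<cong>\<^sub>a\<^sub>l\<^sub>g quaternion_algebra (- a) (- b)"
proof -
  let ?H = "quaternion_algebra (- a) (- b)"
  define C where "C = clifford_algebra V q"
  have sub: "subspace V"
  proof (rule subspaceI)
    show "0 \<in> V"
      unfolding V by (auto intro: exI[of _ 0])
    show "w + w' \<in> V" if w: "w \<in> V" "w' \<in> V" for w w'
    proof -
      obtain x y x' y' where "w = x *\<^sub>R u + y *\<^sub>R v" "w' = x' *\<^sub>R u + y' *\<^sub>R v"
        using w unfolding V by blast
      then have "w + w' = (x + x') *\<^sub>R u + (y + y') *\<^sub>R v"
        by (simp add: algebra_simps)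
      then show ?thesis
        unfolding V by blast
    qed
    show "c *\<^sub>R w \<in> V" if w: "w \<in> V" for c w
    proof -
      obtain x y where "w = x *\<^sub>R u + y *\<^sub>R v"
        using w unfolding V by blast
      then have "c *\<^sub>R w = (c * x) *\<^sub>R u + (c * y) *\<^sub>R v"
        by (simp add: algebra_simps)
      then show ?thesis
        unfolding V by blast
    qed
  qed
  have "\<exists>x y. w = x *\<^sub>R u + y *\<^sub>R v" if "w \<in> V" for w
    using that unfolding V by blast
  then obtain X Y where XY: "w = X w *\<^sub>R u + Y w *\<^sub>R v" if "w \<in> V" for w
    by metis
  have in_V: "x *\<^sub>R u + y *\<^sub>R v \<in> V" for x y
    unfolding V by blast
  \<comment> \<open>The coordinate functions are arbitrary choices, which independence makes unique.\<close>
  have coord: "X (x *\<^sub>R u + y *\<^sub>R v) = x" "Y (x *\<^sub>R u + y *\<^sub>R v) = y" for x y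
    using indep[of "x - X (x *\<^sub>R u + y *\<^sub>R v)" "y - Y (x *\<^sub>R u + y *\<^sub>R v)"] XY[OF in_V[of x y]]
    by (simp_all add: algebra_simps)
  define g :: "'v \<Rightarrow> quat" where "g w = (0, X w, Y w, 0)" for w
  have uv: "u \<in> V" "v \<in> V" "u + v \<in> V" and quv: "q u = a" "q v = b" "q (u + v) = a + b"
    using in_V[of 1 0] in_V[of 0 1] in_V[of 1 1] q[of 1 0] q[of 0 1] q[of 1 1] by simp_all
  have guv: "g u = (0, 1, 0, 0)" "g v = (0, 0, 1, 0)"
    using coord[of 1 0] coord[of 0 1] by (simp_all add: g_def)

  have "\<exists>k\<in>alg_hom C ?H. \<forall>x\<in>V. k (clifford_of V q x) = g x"
    unfolding C_def
  proof (rule clifford_universal[OF sub real_algebra_quaternion_algebra])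
    fix c d w w' assume w: "w \<in> V" "w' \<in> V"
    have "c *\<^sub>R w + d *\<^sub>R w' = (c * X w + d * X w') *\<^sub>R u + (c * Y w + d * Y w') *\<^sub>R v"
      by (subst XY[OF w(1)], subst XY[OF w(2)]) (simp add: algebra_simps)
    then show "g (c *\<^sub>R w + d *\<^sub>R w') = c \<odot>\<^bsub>?H\<^esub> g w \<oplus>\<^bsub>?H\<^esub> d \<odot>\<^bsub>?H\<^esub> g w'"
      by (simp only: g_def coord) (simp add: quaternion_algebra_def)
  next
    fix w assume w: "w \<in> V"
    have "q w = a * (X w)\<^sup>2 + b * (Y w)\<^sup>2"
      using q[of "X w" "Y w"] XY[OF w] by simp
    then show "g w \<otimes>\<^bsub>?H\<^esub> g w = q w \<odot>\<^bsub>?H\<^esub> \<one>\<^bsub>?H\<^esub>"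
      by (simp add: g_def quaternion_algebra_def power2_eq_square algebra_simps)
  qed (simp add: quaternion_algebra_def)
  then obtain k where k: "k \<in> alg_hom C ?H" and k_of: "\<And>x. x \<in> V \<Longrightarrow> k (clifford_of V q x) = g x"
    by blast

  interpret C: real_algebra C
    unfolding C_def by (rule real_algebra_clifford_algebra[OF sub])
  let ?U = "clifford_of V q u" and ?V = "clifford_of V q v"
  note of_closed = clifford_of_closed[OF sub, of _ q, folded C_def]
  have lin: "clifford_of V q (x *\<^sub>R u + y *\<^sub>R v) = x \<odot>\<^bsub>C\<^esub> ?U \<oplus>\<^bsub>C\<^esub> y \<odot>\<^bsub>C\<^esub> ?V" for x y
    unfolding C_def by (rule clifford_of_linear[OF sub uv(1,2)])
  have sq: "?U \<otimes>\<^bsub>C\<^esub> ?U = a \<odot>\<^bsub>C\<^esub> \<one>\<^bsub>C\<^esub>" "?V \<otimes>\<^bsub>C\<^esub> ?V = b \<odot>\<^bsub>C\<^esub> \<one>\<^bsub>C\<^esub>"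
    using clifford_of_square[OF sub uv(1), of q] clifford_of_square[OF sub uv(2), of q]
    by (simp_all add: quv C_def)
  moreover have "(?U \<oplus>\<^bsub>C\<^esub> ?V) \<otimes>\<^bsub>C\<^esub> (?U \<oplus>\<^bsub>C\<^esub> ?V) = (a + b) \<odot>\<^bsub>C\<^esub> \<one>\<^bsub>C\<^esub>"
    using clifford_of_square[OF sub uv(3), of q, folded C_def] lin[of 1 1] uv
    by (simp add: quv of_closed)
  ultimately have VU: "?V \<otimes>\<^bsub>C\<^esub> ?U = (-1) \<odot>\<^bsub>C\<^esub> (?U \<otimes>\<^bsub>C\<^esub> ?V)"
    by (intro C.anticommute of_closed uv)
  note comb = C.mult_quat_comb[OF of_closed[OF uv(1)] of_closed[OF uv(2)] sq VU]
    and comb_closed = C.quat_comb_closed[OF of_closed[OF uv(1)] of_closed[OF uv(2)] sq VU]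
    and comb_add = C.quat_comb_add[OF of_closed[OF uv(1)] of_closed[OF uv(2)] sq VU]
    and comb_smult = C.quat_comb_smult[OF of_closed[OF uv(1)] of_closed[OF uv(2)] sq VU]
  let ?s = "quat_comb C ?U ?V"
  have k_s: "k (?s h) = h" for h
    using uv by (cases h) (simp add: quat_comb_def alg_hom_simps[OF k] of_closed k_of guv,
        simp add: quaternion_algebra_def)
  have surj: "\<exists>h. y = ?s h" if "y \<in> carrier C" for y
    using that
  proof (rule clifford_algebra_induct[OF sub, of y q "\<lambda>y. \<exists>h. y = ?s h", folded C_def])
    have "\<one>\<^bsub>C\<^esub> = ?s (1, 0, 0, 0)"
      using uv by (simp add: quat_comb_def of_closed)
    then show "\<exists>h. \<one>\<^bsub>C\<^esub> = ?s h" ..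
  next
    fix x y assume "\<exists>h. x = ?s h" "\<exists>h. y = ?s h"
    then show "\<exists>h. x \<oplus>\<^bsub>C\<^esub> y = ?s h"
      using comb_add by metis
  next
    fix c y assume "\<exists>h. y = ?s h"
    then show "\<exists>h. c \<odot>\<^bsub>C\<^esub> y = ?s h"
      using comb_smult by metis
  next
    fix x y assume x: "x \<in> V" and "y \<in> carrier C" and "\<exists>h. y = ?s h"
    then obtain a1 a2 a3 a4 where y: "y = ?s (a1, a2, a3, a4)"
      by (metis prod_cases4)
    have "clifford_of V q x \<otimes>\<^bsub>C\<^esub> y
        = X x \<odot>\<^bsub>C\<^esub> (?U \<otimes>\<^bsub>C\<^esub> y) \<oplus>\<^bsub>C\<^esub> Y x \<odot>\<^bsub>C\<^esub> (?V \<otimes>\<^bsub>C\<^esub> y)"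
      using uv \<open>y \<in> carrier C\<close>
      by (subst XY[OF x], subst lin) (simp add: C.l_distr of_closed)
    then show "\<exists>h. clifford_of V q x \<otimes>\<^bsub>C\<^esub> y = ?s h"
      unfolding y comb by (metis comb_add comb_smult)
  qed
  have s_k: "?s (k y) = y" if y: "y \<in> carrier C" for y
  proof -
    obtain h where "y = ?s h"
      using surj[OF y] by blast
    then show ?thesis
      by (simp only: k_s)
  qed
  have "bij_betw k (carrier C) (carrier ?H)"
  proof (rule bij_betw_byWitness[of _ ?s])
    show "\<forall>y\<in>carrier C. ?s (k y) = y" "\<forall>h\<in>carrier ?H. k (?s h) = h"
      using s_k k_s by blast+
    show "k ` carrier C \<subseteq> carrier ?H" "?s ` carrier ?H \<subseteq> carrier C"
      using alg_hom_closed[OF k] comb_closed by blast+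
  qed
  then show ?thesis
    using k unfolding C_def by (intro alg_isomorphicI)
qed

text \<open>
  The elements \<open>s e\<^sub>2\<close> and \<open>t e\<^sub>3\<close> of \<open>H(\<beta>\<^sub>1, \<beta>\<^sub>2)\<close> anticommute and have squares
  \<open>- \<beta>\<^sub>1 s\<^sup>2\<close> and \<open>- \<beta>\<^sub>2 t\<^sup>2\<close>. Hence over the reals only the signs of the two parameters matter.
\<close>

lemma quaternion_algebra_rescale:
  assumes "s \<noteq> 0" "t \<noteq> 0"
  shows "quaternion_algebra (\<beta>1 * s\<^sup>2) (\<beta>2 * t\<^sup>2) \<cong>\<^sub>a\<^sub>l\<^sub>g quaternion_algebra \<beta>1 \<beta>2"
proof (rule alg_isomorphicI)
  let ?h = "\<lambda>(a1, a2, a3, a4). (a1, s * a2, t * a3, s * t * a4) :: quat"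
  show "?h \<in> alg_hom (quaternion_algebra (\<beta>1 * s\<^sup>2) (\<beta>2 * t\<^sup>2)) (quaternion_algebra \<beta>1 \<beta>2)"
    by (rule alg_homI) (auto simp: quaternion_algebra_def power2_eq_square algebra_simps)
  show "bij_betw ?h (carrier (quaternion_algebra (\<beta>1 * s\<^sup>2) (\<beta>2 * t\<^sup>2))) (carrier (quaternion_algebra \<beta>1 \<beta>2))"
    by (rule bij_betw_byWitness[of _ "\<lambda>(a1, a2, a3, a4). (a1, a2 / s, a3 / t, a4 / (s * t))"])
       (use assms in \<open>auto simp: quaternion_algebra_def\<close>)
qed

section \<open>The sign of the norms of Fibonacci quaternions\<close>

lemma fib_shift_asymptotics:
  defines "\<alpha> \<equiv> (1 + sqrt 5) / 2"
  shows "(\<lambda>n. real (fib (n + k)) / \<alpha> ^ n) \<longlonglongrightarrow> \<alpha> ^ k / sqrt 5"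
proof -
  have "\<alpha> > 0"
    by (simp add: \<alpha>_def add_pos_nonneg)
  have "(\<lambda>n. real (fib (n + k)) / (\<alpha> ^ (n + k) / sqrt 5) * (\<alpha> ^ k / sqrt 5)) \<longlonglongrightarrow> 1 * (\<alpha> ^ k / sqrt 5)"
    using LIMSEQ_ignore_initial_segment[OF fib_asymptotics, of k]
    by (intro tendsto_mult tendsto_const) (simp add: \<alpha>_def)
  then show ?thesis
    using \<open>\<alpha> > 0\<close> by (simp add: power_add)
qed

text \<open>
  Each coordinate of the Fibonacci quaternion grows like \<open>\<alpha>\<^sup>n\<close>, so the norm is asymptotic to
  \<open>\<alpha>\<^sup>2\<^sup>n (1 + \<beta>\<^sub>1 \<alpha>\<^sup>2 + \<beta>\<^sub>2 \<alpha>\<^sup>4 + \<beta>\<^sub>1 \<beta>\<^sub>2 \<alpha>\<^sup>6) / 5\<close>. The coefficient turns into the expression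
  \<open>E\<close>, which is linear in \<open>\<alpha>\<close>, by means of \<open>\<alpha>\<^sup>2 = \<alpha> + 1\<close>, \<open>\<alpha>\<^sup>4 = 3 \<alpha> + 2\<close> and \<open>\<alpha>\<^sup>6 = 8 \<alpha> + 5\<close>.
\<close>

lemma quat_norm_fib_quat_asymptotics:
  defines "\<alpha> \<equiv> (1 + sqrt 5) / 2"
  shows "(\<lambda>n. quat_norm \<beta>1 \<beta>2 (fib_quat n) / (\<alpha> ^ n)\<^sup>2) \<longlonglongrightarrow> E_coeff \<beta>1 \<beta>2"
proof -
  let ?r = "\<lambda>k n. real (fib (n + k)) / \<alpha> ^ n"
  have "(\<lambda>n. (?r 0 n)\<^sup>2 + \<beta>1 * (?r 1 n)\<^sup>2 + \<beta>2 * (?r 2 n)\<^sup>2 + \<beta>1 * \<beta>2 * (?r 3 n)\<^sup>2) \<longlonglongrightarrow>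
      (\<alpha> ^ 0 / sqrt 5)\<^sup>2 + \<beta>1 * (\<alpha> ^ 1 / sqrt 5)\<^sup>2 + \<beta>2 * (\<alpha> ^ 2 / sqrt 5)\<^sup>2 + \<beta>1 * \<beta>2 * (\<alpha> ^ 3 / sqrt 5)\<^sup>2"
    unfolding \<alpha>_def by (intro tendsto_intros fib_shift_asymptotics)
  also have "(\<lambda>n. (?r 0 n)\<^sup>2 + \<beta>1 * (?r 1 n)\<^sup>2 + \<beta>2 * (?r 2 n)\<^sup>2 + \<beta>1 * \<beta>2 * (?r 3 n)\<^sup>2)
      = (\<lambda>n. quat_norm \<beta>1 \<beta>2 (fib_quat n) / (\<alpha> ^ n)\<^sup>2)"
    by (simp only: fib_quat_def quat_norm.simps power_divide times_divide_eq_right add_divide_distrib add_0_right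
        prod.case)
  also have "(\<alpha> ^ 0 / sqrt 5)\<^sup>2 + \<beta>1 * (\<alpha> ^ 1 / sqrt 5)\<^sup>2 + \<beta>2 * (\<alpha> ^ 2 / sqrt 5)\<^sup>2 + \<beta>1 * \<beta>2 * (\<alpha> ^ 3 / sqrt 5)\<^sup>2
      = E_coeff \<beta>1 \<beta>2"
  proof -
    have 2: "\<alpha> ^ 2 = \<alpha> + 1"
      by (simp add: \<alpha>_def power2_eq_square field_simps)
    have 4: "(\<alpha> ^ 2) ^ 2 = 3 * \<alpha> + 2"
      by (subst 2) (simp add: power2_sum 2)
    have "(\<alpha> ^ 3) ^ 2 = \<alpha> ^ 2 * (\<alpha> ^ 2) ^ 2"
      by (simp flip: power_mult power_add)
    also have "\<dots> = 3 * \<alpha> ^ 2 + 5 * \<alpha> + 2"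
      unfolding 4 by (subst 2) (simp add: algebra_simps flip: power2_eq_square)
    also have "\<dots> = 8 * \<alpha> + 5"
      by (simp add: 2)
    finally have 6: "(\<alpha> ^ 3) ^ 2 = 8 * \<alpha> + 5" .
    show ?thesis
      by (simp only: power_divide 4 6) (simp add: 2 E_coeff_def Let_def \<alpha>_def[symmetric] field_simps)
  qed
  finally show ?thesis .
qed

lemma eventually_quat_norm_fib_quat_sign:
  "E_coeff \<beta>1 \<beta>2 > 0 \<Longrightarrow> eventually (\<lambda>n. quat_norm \<beta>1 \<beta>2 (fib_quat n) > 0) sequentially"
  "E_coeff \<beta>1 \<beta>2 < 0 \<Longrightarrow> eventually (\<lambda>n. quat_norm \<beta>1 \<beta>2 (fib_quat n) < 0) sequentially"
proof -
  have \<alpha>: "(1 + sqrt 5) / 2 > (0::real)"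
    by (simp add: add_pos_nonneg)
  show "eventually (\<lambda>n. quat_norm \<beta>1 \<beta>2 (fib_quat n) > 0) sequentially" if "E_coeff \<beta>1 \<beta>2 > 0"
    using order_tendstoD(1)[OF quat_norm_fib_quat_asymptotics that]
    by eventually_elim (use \<alpha> in \<open>auto simp: zero_less_divide_iff\<close>)
  show "eventually (\<lambda>n. quat_norm \<beta>1 \<beta>2 (fib_quat n) < 0) sequentially" if "E_coeff \<beta>1 \<beta>2 < 0"
    using order_tendstoD(2)[OF quat_norm_fib_quat_asymptotics that]
    by eventually_elim (use \<alpha> in \<open>auto simp: divide_less_0_iff\<close>)
qed

section \<open>Clifford algebras of Fibonacci quaternions\<close>

lemma clifford_fib_quat_space:
  "clifford_algebra (fib_quat_space n) (fib_quat_form \<beta>1 \<beta>2 n) \<cong>\<^sub>a\<^sub>l\<^sub>g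
   quaternion_algebra (- quat_norm \<beta>1 \<beta>2 (fib_quat n)) (- quat_norm \<beta>1 \<beta>2 (fib_quat (n + 1)))"
proof (rule clifford_plane)
  show "x = 0 \<and> y = 0" if "x *\<^sub>R fib_quat n + y *\<^sub>R fib_quat (n + 1) = 0" for x y
    using fib_quat_inject[of x n y 0 0] that by simp
  have "0 = 0 *\<^sub>R fib_quat n + 0 *\<^sub>R fib_quat (n + 1)"
    by simp
  then show "fib_quat_space n = {x *\<^sub>R fib_quat n + y *\<^sub>R fib_quat (n + 1) | x y. True}"
    unfolding fib_quat_space_def gen_fib_quat_def by blast
qed (rule fib_quat_form_eq)


theorem theorem3p6:
  fixes \<beta>1 \<beta>2 :: real
  assumes "\<not> division_algebra (quaternion_algebra \<beta>1 \<beta>2)"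
  shows "\<exists>n'::nat. \<forall>n\<ge>n'.
    (E_coeff \<beta>1 \<beta>2 > 0 \<longrightarrow>
       clifford_algebra (fib_quat_space n) (fib_quat_form \<beta>1 \<beta>2 n) \<cong>\<^sub>a\<^sub>l\<^sub>g quaternion_algebra (-1) (-1)) \<and>
    (E_coeff \<beta>1 \<beta>2 < 0 \<longrightarrow>
       clifford_algebra (fib_quat_space n) (fib_quat_form \<beta>1 \<beta>2 n) \<cong>\<^sub>a\<^sub>l\<^sub>g quaternion_algebra 1 1)"
proof -
  let ?N = "\<lambda>n. quat_norm \<beta>1 \<beta>2 (fib_quat n)"
  have "eventually (\<lambda>n. (E_coeff \<beta>1 \<beta>2 > 0 \<longrightarrow> ?N n > 0) \<and> (E_coeff \<beta>1 \<beta>2 < 0 \<longrightarrow> ?N n < 0)) sequentially"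
    using eventually_quat_norm_fib_quat_sign[of \<beta>1 \<beta>2]
    by (cases "E_coeff \<beta>1 \<beta>2 > 0"; cases "E_coeff \<beta>1 \<beta>2 < 0") auto
  then obtain n' where n': "\<And>n. n \<ge> n' \<Longrightarrow>
      (E_coeff \<beta>1 \<beta>2 > 0 \<longrightarrow> ?N n > 0) \<and> (E_coeff \<beta>1 \<beta>2 < 0 \<longrightarrow> ?N n < 0)"
    unfolding eventually_sequentially by blast
  show ?thesis
  proof (intro exI[of _ n'] allI impI conjI)
    fix n assume n: "n \<ge> n'"
    assume "E_coeff \<beta>1 \<beta>2 > 0"
    then have pos: "?N n > 0" "?N (n + 1) > 0"
      using n'[of n] n'[of "n + 1"] n by auto
    \<comment> \<open>The square roots of the norms, as scaling factors, normalize both parameters to \<open>-1\<close>.\<close>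
    have "quaternion_algebra (- ?N n) (- ?N (n + 1)) \<cong>\<^sub>a\<^sub>l\<^sub>g quaternion_algebra (-1) (-1)"
      using quaternion_algebra_rescale[of "sqrt (?N n)" "sqrt (?N (n + 1))" "-1" "-1"] pos
      by (simp del: add_Suc_right Suc_eq_plus1)
    then show "clifford_algebra (fib_quat_space n) (fib_quat_form \<beta>1 \<beta>2 n) \<cong>\<^sub>a\<^sub>l\<^sub>g quaternion_algebra (-1) (-1)"
      by (rule alg_isomorphic_trans[OF clifford_fib_quat_space])
  next
    fix n assume n: "n \<ge> n'"
    assume "E_coeff \<beta>1 \<beta>2 < 0"
    then have neg: "?N n < 0" "?N (n + 1) < 0"
      using n'[of n] n'[of "n + 1"] n by auto
    have "quaternion_algebra (- ?N n) (- ?N (n + 1)) \<cong>\<^sub>a\<^sub>l\<^sub>g quaternion_algebra 1 1"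
      using quaternion_algebra_rescale[of "sqrt (- ?N n)" "sqrt (- ?N (n + 1))" 1 1] neg
      by (simp del: add_Suc_right Suc_eq_plus1)
    then show "clifford_algebra (fib_quat_space n) (fib_quat_form \<beta>1 \<beta>2 n) \<cong>\<^sub>a\<^sub>l\<^sub>g quaternion_algebra 1 1"
      by (rule alg_isomorphic_trans[OF clifford_fib_quat_space])
  qed
qed

end
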